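(* Let $x$ be transcendental over $\mathbb{Q}$ and let $y$ be a solution of $$y^5+5y^3+5y-11=\frac{(x-1)^5}{x^4+x^3+6x^2+6x+11}.\qquad (\mathrm{E})$$ Let $v$ satisfy $1/v-v=x$. Then the function field $\mathbb{Q}(v,y)$ contains a solution $w$ of $1/w-w=y$ such that $$w^5=v\,\frac{v^4-3v^3+4v^2-2v+1}{v^4+2v^3+4v^2+3v+1}.$$ Consequently, the tower over $\mathbb{Q}$ defined recursively by $$y^5=x\,\frac{x^4-3x^3+4x^2-2x+1}{x^4+2x^3+4x^2+3x+1}\qquad(\mathrm{L})$$ is a supertower of the tower of function fields of the classical modular curves $(X_0(5^n))_{n\ge2}$; that is, the fields $\mathbb{Q}(v_0,\dots,v_n)$, where each pair $(x,y)=(v_i,v_{i+1})$ satisfies (L), contain as subfields the fields $\mathbb{Q}(x_0,\dots,x_n)$, with $x_i=1/v_i-v_i$, of the recursive tower in which each pair $(x,y)=(x_i,x_{i+1})$ satisfies (E).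
   Context: A tower of function fields is said to satisfy a recursive equation $f(x,y)=0$ if its $n$-th field is generated over the constant field by elements $x_0,\dots,x_n$ with $x_0$ transcendental and $f(x_i,x_{i+1})=0$ for $0\le i<n$. By a result of Elkies, the tower of function fields over $\mathbb{Q}$ of the classical modular curves $(X_0(5^n))_{n\ge 2}$ satisfies the recursive equation (E), which is equivalent to $P(y)=125/P\left(\frac{x+4}{x-1}\right)$ with $P(t)=t^5+5t^3+5t-11$. *)

theory Defs
  imports
    "HOL-Algebra.Generated_Fields"
    "HOL-Algebra.Algebraic_Closure_Type"
    "HOL-Computational_Algebra.Formal_Laurent_Series"
begin

text \<open>
  All fields are subfields of some ambient field of characteristic 0, given as a type.
  The field \<open>\<rat>(S)\<close> is the subfield generated by \<open>S\<close>; \<open>x\<close> is transcendental over \<open>\<rat>\<close> iff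
  \<open>\<not> Polynomial.algebraic x\<close>.
\<close>

definition Q_adjoin :: "'a::field_char_0 set \<Rightarrow> 'a set" where
  "Q_adjoin S = generate_field ring_of_type_algebra S"


section \<open>Recursive towers\<close>

text \<open>
  A recursive equation is given as a relation. All elements of the sequences below are
  transcendental when the relation is (E) or (L), so the denominators in these two
  equations do not vanish and the convention \<open>a / 0 = 0\<close> is never used.
\<close>

definition recursive_sequence ::
    "('a::field_char_0 \<Rightarrow> 'a \<Rightarrow> bool) \<Rightarrow> nat \<Rightarrow> (nat \<Rightarrow> 'a) \<Rightarrow> bool" where
  "recursive_sequence f n x \<longleftrightarrow> \<not> Polynomial.algebraic (x 0) \<and> (\<forall>i<n. f (x i) (x (Suc i)))"

definition satisfies_recursive_equation ::
    "(nat \<Rightarrow> 'a::field_char_0 set) \<Rightarrow> ('a \<Rightarrow> 'a \<Rightarrow> bool) \<Rightarrow> bool" where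
  "satisfies_recursive_equation F f \<longleftrightarrow>
     (\<exists>x. \<forall>n. recursive_sequence f n x \<and> F n = Q_adjoin (x ` {..n}))"

definition eq_E :: "'a::field_char_0 \<Rightarrow> 'a \<Rightarrow> bool" where
  "eq_E x y \<longleftrightarrow>
     y^5 + 5*y^3 + 5*y - 11 = (x - 1)^5 / (x^4 + x^3 + 6*x^2 + 6*x + 11)"

definition eq_L :: "'a::field_char_0 \<Rightarrow> 'a \<Rightarrow> bool" where
  "eq_L x y \<longleftrightarrow>
     y^5 = x * ((x^4 - 3*x^3 + 4*x^2 - 2*x + 1) / (x^4 + 2*x^3 + 4*x^2 + 3*x + 1))"

text \<open>
  The two towers may live in different ambient fields, so containment is up to a field
  embedding of the union of the lower tower that is compatible with all levels.
  A ring homomorphism out of a field that preserves 1 is injective.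
\<close>

definition is_supertower ::
    "(nat \<Rightarrow> 'b::field_char_0 set) \<Rightarrow> (nat \<Rightarrow> 'a::field_char_0 set) \<Rightarrow> bool" where
  "is_supertower G F \<longleftrightarrow>
     (\<exists>\<phi> \<in> ring_hom (ring_of_type_algebra\<lparr>carrier := (\<Union>n. F n)\<rparr>) ring_of_type_algebra.
        \<forall>n. \<phi> ` F n \<subseteq> G n)"


section \<open>Function fields of the classical modular curves\<close>

text \<open>
  The function field over \<open>\<rat>\<close> of \<open>X\<^sub>0(N)\<close> is \<open>\<rat>(j(\<tau>), j(N\<tau>))\<close>. It is identified with its
  image under the \<open>q\<close>-expansion at infinity, a subfield of the field of formal Laurent
  series over \<open>\<rat>\<close> in \<open>q = exp(2\<pi>i\<tau>)\<close>; \<open>j(N\<tau>)\<close> is obtained by substituting \<open>q\<^sup>N\<close> for \<open>q\<close>.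
\<close>

definition Eisenstein4 :: "rat fps" where
  "Eisenstein4 = Abs_fps (\<lambda>n. if n = 0 then 1 else 240 * (\<Sum>d | d dvd n. of_nat (d^3)))"

definition Eisenstein6 :: "rat fps" where
  "Eisenstein6 = Abs_fps (\<lambda>n. if n = 0 then 1 else - 504 * (\<Sum>d | d dvd n. of_nat (d^5)))"

definition j_series :: "rat fls" where
  "j_series = 1728 * fps_to_fls (Eisenstein4^3) / fps_to_fls (Eisenstein4^3 - Eisenstein6^2)"

definition X0_function_field :: "nat \<Rightarrow> rat fls set" where
  "X0_function_field N = Q_adjoin {j_series, fls_compose_power j_series N}"

definition X0_tower :: "nat \<Rightarrow> rat fls set" where
  "X0_tower n = X0_function_field (5 ^ (n + 2))"

end

theory Submission
  imports Defs
begin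

text \<open>
  With \<open>1/v - v = x\<close>, let \<open>N(v)\<close> and \<open>D(v)\<close> be the numerator and denominator quartics of (L) and
  \<open>F(x)\<close> the denominator of (E). The substitution \<open>v \<mapsto> -1/v\<close> fixes \<open>x\<close> and exchanges \<open>D(v)/v^2\<close> and
  \<open>N(v)/v^2\<close>, and \<open>N(v) D(v) = v^4 F(x)\<close>. Hence \<open>W = v N(v)/D(v)\<close> satisfies
  \<open>1/W - W = (x-1)^5/F(x) + 11\<close> (\<open>quotient_L\<close>). On the other side, \<open>1/w - w = y\<close> implies
  \<open>1/w^5 - w^5 = y^5 + 5y^3 + 5y\<close> (\<open>dickson_5\<close>). So (L) for \<open>(v, w)\<close> implies (E) for
  \<open>(1/v - v, 1/w - w)\<close>; conversely, if \<open>(x, y)\<close> satisfies (E), then reducing \<open>w^5 = W\<close> modulo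
  \<open>w^2 = 1 - y w\<close> gives a linear equation for \<open>w\<close> over \<open>\<rat>(v, y)\<close>, whose solution is the required
  root (\<open>quintic_root\<close>).

  For the comparison of the towers it remains to see that any two towers satisfying (E) are
  isomorphic, that is, that the quintic polynomial (E) is irreducible at each level. It is, because
  the pole of \<open>x\<^sub>0\<close> is totally ramified: at a place where \<open>x\<^sub>n\<close> has a simple pole, the right-hand
  side of (E) has a simple pole, while the left-hand side is a quintic polynomial in \<open>x\<^sub>n\<^sub>+\<^sub>1\<close>; so the
  ramification index is 5, and \<open>x\<^sub>n\<^sub>+\<^sub>1\<close> has a simple pole again. Concretely, the field \<open>\<rat>((t))\<close> has an
  endomorphism \<open>\<sigma>\<close> that multiplies all orders by 5 and for which \<open>(\<sigma>(1/t), 1/t)\<close> satisfies (E)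
  (\<open>eq_E_tower_shift\<close>). By induction on \<open>n\<close>, for each sequence satisfying (E) the map
  \<open>x\<^sub>i \<mapsto> \<sigma>\<^sup>n\<^sup>-\<^sup>i(1/t)\<close> extends to an embedding \<open>\<rat>(x\<^sub>0,\<dots>,x\<^sub>n) \<rightarrow> \<rat>((t))\<close>
  (\<open>embed_in_laurent_series\<close>): no nonzero polynomial of degree less than 5 over the image of \<open>\<sigma>\<close>
  vanishes at \<open>1/t\<close>, since its terms have orders that are distinct modulo 5. As the image of this
  embedding depends on \<open>n\<close> only, two such sequences generate isomorphic fields, and uniqueness of
  the isomorphisms makes them compatible for all \<open>n\<close> (\<open>eq_E_tower_hom\<close>). In particular the tower
  with elements \<open>1/v\<^sub>i - v\<^sub>i\<close> inside the tower of (L) is a copy of any given tower satisfying (E).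
\<close>

section \<open>Subfields and their homomorphisms\<close>

text \<open>
  A subfield of a field that is a type. Closure under inverses includes the harmless case
  \<open>inverse 0 = 0\<close>.
\<close>

locale type_subfield =
  fixes K :: "'a::field set"
  assumes zero_mem [simp]: "0 \<in> K"
    and one_mem [simp]: "1 \<in> K"
    and add_mem: "a \<in> K \<Longrightarrow> b \<in> K \<Longrightarrow> a + b \<in> K"
    and mult_mem: "a \<in> K \<Longrightarrow> b \<in> K \<Longrightarrow> a * b \<in> K"
    and uminus_mem: "a \<in> K \<Longrightarrow> - a \<in> K"
    and inverse_mem: "a \<in> K \<Longrightarrow> inverse a \<in> K"
begin

lemma diff_mem: "a \<in> K \<Longrightarrow> b \<in> K \<Longrightarrow> a - b \<in> K"
  using add_mem[of a "- b"] uminus_mem by simp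

lemma divide_mem: "a \<in> K \<Longrightarrow> b \<in> K \<Longrightarrow> a / b \<in> K"
  by (simp add: divide_inverse mult_mem inverse_mem)

lemma power_mem: "a \<in> K \<Longrightarrow> a ^ n \<in> K"
  by (induction n) (auto intro: mult_mem)

lemma of_nat_mem: "of_nat n \<in> K"
  by (induction n) (auto intro: add_mem)

lemma numeral_mem [simp]: "numeral k \<in> K"
  using of_nat_mem[of "numeral k"] by simp

lemma sum_mem: "(\<And>i. i \<in> A \<Longrightarrow> f i \<in> K) \<Longrightarrow> sum f A \<in> K"
  by (induction A rule: infinite_finite_induct) (auto intro: add_mem)

text \<open>
  The polynomials with coefficients in \<open>K\<close>, inside the polynomials over the ambient field.
\<close>

definition polys :: "'a poly set" where
  "polys = {p. \<forall>i. coeff p i \<in> K}"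

lemma coeff_mem: "p \<in> polys \<Longrightarrow> coeff p i \<in> K"
  by (simp add: polys_def)

lemma polys_0 [simp]: "0 \<in> polys"
  by (simp add: polys_def)

lemma polys_pCons: "a \<in> K \<Longrightarrow> p \<in> polys \<Longrightarrow> pCons a p \<in> polys"
  by (auto simp: polys_def coeff_pCons split: nat.splits)

lemma polys_1 [simp]: "1 \<in> polys"
  by (simp add: one_pCons polys_pCons)

lemma polys_add: "p \<in> polys \<Longrightarrow> q \<in> polys \<Longrightarrow> p + q \<in> polys"
  by (auto simp: polys_def intro: add_mem)

lemma polys_uminus: "p \<in> polys \<Longrightarrow> - p \<in> polys"
  by (auto simp: polys_def intro: uminus_mem)

lemma polys_diff: "p \<in> polys \<Longrightarrow> q \<in> polys \<Longrightarrow> p - q \<in> polys"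
  by (auto simp: polys_def intro: diff_mem)

lemma polys_mult: "p \<in> polys \<Longrightarrow> q \<in> polys \<Longrightarrow> p * q \<in> polys"
  by (auto simp: polys_def coeff_mult intro!: sum_mem mult_mem)

lemma polys_monom: "a \<in> K \<Longrightarrow> monom a n \<in> polys"
  by (auto simp: polys_def)

lemma polys_power: "p \<in> polys \<Longrightarrow> p ^ n \<in> polys"
  by (induction n) (auto intro: polys_mult)

lemma polys_smult: "a \<in> K \<Longrightarrow> p \<in> polys \<Longrightarrow> smult a p \<in> polys"
  by (auto simp: polys_def intro: mult_mem)

lemma polys_sum:
  "(\<And>i. i \<in> A \<Longrightarrow> f i \<in> polys) \<Longrightarrow> sum f A \<in> polys"
  by (induction A rule: infinite_finite_induct) (auto intro: polys_add)

lemma polys_division: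
  assumes "p \<in> polys" and q: "q \<in> polys" "q \<noteq> 0"
  shows "\<exists>s\<in>polys. \<exists>r\<in>polys. p = q * s + r \<and> (r = 0 \<or> degree r < degree q)"
  using assms(1)
proof (induction "if p = 0 then 0 else Suc (degree p)" arbitrary: p rule: less_induct)
  case less
  show ?case
  proof (cases "p = 0 \<or> degree p < degree q")
    case True
    then show ?thesis using less.prems by (intro bexI[of _ 0] bexI[of _ p]) auto
  next
    case False
    define m where "m = monom (lead_coeff p / lead_coeff q) (degree p - degree q)"
    have m: "m \<in> polys"
      unfolding m_def by (intro polys_monom divide_mem coeff_mem less.prems q)
    define p' where "p' = p - q * m"
    have p': "p' \<in> polys"
      unfolding p'_def by (intro polys_diff polys_mult less.prems q m)
    have c0: "lead_coeff p / lead_coeff q \<noteq> 0" using False q by auto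
    hence m0: "m \<noteq> 0" by (simp add: m_def)
    have degm': "degree m = degree p - degree q"
      unfolding m_def by (rule Polynomial.degree_monom_eq[OF c0])
    have degm: "degree (q * m) = degree p"
      using False q m0 degm' by (simp add: degree_mult_eq)
    have "lead_coeff m = lead_coeff p / lead_coeff q"
      unfolding degm' by (simp add: m_def)
    hence lc: "lead_coeff (q * m) = lead_coeff p"
      using q c0 by (simp add: lead_coeff_mult)
    have "p' = 0 \<or> degree p' < degree p"
    proof (cases "degree p = 0")
      case True
      hence "degree p' = 0" unfolding p'_def
        using degm degree_diff_le_max[of p "q * m"] by simp
      moreover have "coeff p' 0 = 0" using lc degm True by (simp add: p'_def)
      ultimately show ?thesis by (metis leading_coeff_0_iff)
    next
      case F: False
      have "degree p' \<le> degree p" unfolding p'_def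
        using degm degree_diff_le_max[of p "q * m"] by simp
      moreover have "coeff p' (degree p) = 0" using lc degm by (simp add: p'_def)
      ultimately show ?thesis by (metis leading_coeff_0_iff le_neq_implies_less)
    qed
    hence "(if p' = 0 then 0 else Suc (degree p')) < (if p = 0 then 0 else Suc (degree p))"
      using False by auto
    from less.hyps[OF this p'] obtain s r where sr: "s \<in> polys" "r \<in> polys"
      "p' = q * s + r" "r = 0 \<or> degree r < degree q" by blast
    have "p = q * (s + m) + r" using sr(3) by (simp add: p'_def algebra_simps)
    with sr polys_add[OF sr(1) m] show ?thesis by blast
  qed
qed

end

text \<open>
  A field homomorphism from a subfield \<open>K\<close> into another field. It is a total function, of which only
  the values on \<open>K\<close> matter.
\<close>

locale subfield_hom = type_subfield K for K :: "'a::field set" +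
  fixes \<phi> :: "'a \<Rightarrow> 'b::field"
  assumes hom_one [simp]: "\<phi> 1 = 1"
    and hom_add: "a \<in> K \<Longrightarrow> b \<in> K \<Longrightarrow> \<phi> (a + b) = \<phi> a + \<phi> b"
    and hom_mult: "a \<in> K \<Longrightarrow> b \<in> K \<Longrightarrow> \<phi> (a * b) = \<phi> a * \<phi> b"
begin

lemma hom_zero [simp]: "\<phi> 0 = 0"
  by (metis hom_add zero_mem add_0_right add_left_cancel)

lemma hom_uminus: "a \<in> K \<Longrightarrow> \<phi> (- a) = - \<phi> a"
  using hom_add[of a "- a"] uminus_mem by (simp add: eq_neg_iff_add_eq_0 add.commute)

lemma hom_diff: "a \<in> K \<Longrightarrow> b \<in> K \<Longrightarrow> \<phi> (a - b) = \<phi> a - \<phi> b"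
  using hom_add[of a "- b"] uminus_mem hom_uminus by simp

lemma hom_eq_0_iff: "a \<in> K \<Longrightarrow> \<phi> a = 0 \<longleftrightarrow> a = 0"
  using hom_mult[of a "inverse a"] inverse_mem[of a] by (cases "a = 0") auto

lemma hom_inj: "inj_on \<phi> K"
  by (rule inj_onI) (metis diff_mem hom_diff hom_eq_0_iff right_minus_eq)

lemma hom_inverse: "a \<in> K \<Longrightarrow> \<phi> (inverse a) = inverse (\<phi> a)"
proof (cases "a = 0")
  case False
  assume "a \<in> K"
  hence "\<phi> a * \<phi> (inverse a) = 1" using False hom_mult[of a "inverse a"] inverse_mem by simp
  thus ?thesis by (simp add: inverse_unique)
qed simp

lemma hom_divide: "a \<in> K \<Longrightarrow> b \<in> K \<Longrightarrow> \<phi> (a / b) = \<phi> a / \<phi> b"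
  by (simp add: divide_inverse hom_mult hom_inverse inverse_mem)

lemma hom_power: "a \<in> K \<Longrightarrow> \<phi> (a ^ n) = \<phi> a ^ n"
  by (induction n) (auto simp: hom_mult power_mem)

lemma hom_of_nat: "\<phi> (of_nat n) = of_nat n"
  by (induction n) (auto simp: hom_add of_nat_mem)

lemma hom_numeral [simp]: "\<phi> (numeral k) = numeral k"
  using hom_of_nat[of "numeral k"] by simp

lemma hom_sum: "(\<And>i. i \<in> A \<Longrightarrow> f i \<in> K) \<Longrightarrow> \<phi> (sum f A) = (\<Sum>i\<in>A. \<phi> (f i))"
  by (induction A rule: infinite_finite_induct) (auto simp: hom_add sum_mem)

lemma coeff_map: "coeff (map_poly \<phi> p) i = \<phi> (coeff p i)"
  by (simp add: coeff_map_poly)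

lemma map_poly_pCons_hom: "map_poly \<phi> (pCons a p) = pCons (\<phi> a) (map_poly \<phi> p)"
  by (rule poly_eqI) (auto simp: coeff_map coeff_pCons split: nat.splits)

lemma map_poly_add_hom:
  "p \<in> polys \<Longrightarrow> q \<in> polys \<Longrightarrow> map_poly \<phi> (p + q) = map_poly \<phi> p + map_poly \<phi> q"
  by (rule poly_eqI) (auto simp: coeff_map hom_add coeff_mem)

lemma map_poly_diff_hom:
  "p \<in> polys \<Longrightarrow> q \<in> polys \<Longrightarrow> map_poly \<phi> (p - q) = map_poly \<phi> p - map_poly \<phi> q"
  by (rule poly_eqI) (auto simp: coeff_map hom_diff coeff_mem)

lemma map_poly_mult_hom:
  "p \<in> polys \<Longrightarrow> q \<in> polys \<Longrightarrow> map_poly \<phi> (p * q) = map_poly \<phi> p * map_poly \<phi> q"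
  by (rule poly_eqI) (simp add: coeff_map coeff_mult hom_sum hom_mult coeff_mem mult_mem)

lemma map_poly_eq_0_iff_hom: "p \<in> polys \<Longrightarrow> map_poly \<phi> p = 0 \<longleftrightarrow> p = 0"
  by (simp add: poly_eq_iff coeff_map hom_eq_0_iff coeff_mem)

lemma degree_map_poly_hom: "p \<in> polys \<Longrightarrow> degree (map_poly \<phi> p) = degree p"
  by (cases "p = 0") (auto intro!: map_poly_degree_eq simp: hom_eq_0_iff coeff_mem)

text \<open>
  Let \<open>T\<close> over \<open>K\<close> vanish at \<open>y\<close>, and its image under \<open>\<phi>\<close> at \<open>z\<close>. If that image has the least degree
  among the polynomials over \<open>\<phi>(K)\<close> that vanish at \<open>z\<close>, then \<open>T\<close> is irreducible over \<open>K\<close>, so it is also of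
  least degree for \<open>y\<close>; hence both vanishing ideals consist of the multiples of \<open>T\<close>.
\<close>

lemma vanish_iff:
  assumes T: "T \<in> polys" "T \<noteq> 0" "poly T y = 0" "poly (map_poly \<phi> T) z = 0"
    and irr: "\<And>r. r \<in> polys \<Longrightarrow> degree r < degree T \<Longrightarrow> poly (map_poly \<phi> r) z = 0 \<Longrightarrow> r = 0"
    and q: "q \<in> polys"
  shows "poly q y = 0 \<longleftrightarrow> poly (map_poly \<phi> q) z = 0"
proof -
  have low: "r = 0" if r: "r \<in> polys" "degree r < degree T" "poly r y = 0" for r
  proof (rule ccontr)
    assume "r \<noteq> 0"
    \<comment> \<open>A polynomial of least degree that vanishes at \<open>y\<close> is a proper divisor of \<open>T\<close>.\<close>
    define good where "good r \<longleftrightarrow> r \<in> polys \<and> r \<noteq> 0 \<and> poly r y = 0" for r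
    have "good r" using r \<open>r \<noteq> 0\<close> by (simp add: good_def)
    then obtain m where m: "good m" "\<And>r'. good r' \<Longrightarrow> degree m \<le> degree r'"
      using ex_has_least_nat[of good r degree] by blast
    have mT: "degree m < degree T" using m(2)[OF \<open>good r\<close>] r by simp
    from m(1) have m': "m \<in> polys" "m \<noteq> 0" "poly m y = 0" by (auto simp: good_def)
    from polys_division[OF T(1) m'(1,2)] obtain s r1 where s: "s \<in> polys" "r1 \<in> polys"
      "T = m * s + r1" "r1 = 0 \<or> degree r1 < degree m" by blast
    have "poly r1 y = 0" using arg_cong[OF s(3), of "\<lambda>p. poly p y"] T m' by simp
    hence "r1 = 0" using s m(2)[of r1] by (force simp: good_def)
    hence Tms: "T = m * s" using s by simp
    have s0: "s \<noteq> 0" using T Tms by auto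
    have "degree m > 0"
    proof (rule ccontr)
      assume "\<not> degree m > 0"
      then obtain c where "m = [:c:]" by (metis degree_eq_zeroE neq0_conv)
      thus False using m' by simp
    qed
    hence sT: "degree s < degree T" using m'(2) s0 by (simp add: Tms degree_mult_eq)
    have "poly (map_poly \<phi> m) z * poly (map_poly \<phi> s) z = 0"
      using T(4) m' s by (simp add: Tms map_poly_mult_hom)
    thus False using irr[OF m'(1) mT] irr[OF s(1) sT] m' s0 by auto
  qed
  from polys_division[OF q T(1,2)] obtain s r where s: "s \<in> polys" "r \<in> polys"
      "q = T * s + r" "r = 0 \<or> degree r < degree T" by blast
  have 1: "poly q y = poly r y" using s T by simp
  have 2: "poly (map_poly \<phi> q) z = poly (map_poly \<phi> r) z"
    using s T by (simp add: map_poly_add_hom map_poly_mult_hom polys_mult)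
  show ?thesis unfolding 1 2 using s(4) low[OF s(2)] irr[OF s(2)] by auto
qed

end

lemma subfield_hom_cong:
  assumes "subfield_hom K \<phi>" "\<And>a. a \<in> K \<Longrightarrow> \<psi> a = \<phi> a"
  shows "subfield_hom K \<psi>"
proof -
  interpret subfield_hom K \<phi> by fact
  show ?thesis by unfold_locales (simp_all add: assms(2) add_mem mult_mem hom_add hom_mult)
qed

lemma subfield_hom_comp:
  assumes "subfield_hom K \<phi>" "subfield_hom L \<psi>" "\<phi> ` K \<subseteq> L"
  shows "subfield_hom K (\<lambda>a. \<psi> (\<phi> a))"
proof -
  interpret f: subfield_hom K \<phi> by fact
  interpret g: subfield_hom L \<psi> by fact
  have "\<phi> a \<in> L" if "a \<in> K" for a using assms(3) that by auto
  thus ?thesis by unfold_locales (simp_all add: f.hom_add f.hom_mult g.hom_add g.hom_mult)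
qed

section \<open>Adjunction\<close>

lemma type_algebra_simps [simp]:
  "\<zero>\<^bsub>ring_of_type_algebra\<^esub> = (0::'a::field)"
  "\<one>\<^bsub>ring_of_type_algebra\<^esub> = (1::'a)"
  "a \<oplus>\<^bsub>ring_of_type_algebra\<^esub> b = (a + b :: 'a)"
  "a \<otimes>\<^bsub>ring_of_type_algebra\<^esub> b = (a * b :: 'a)"
  "carrier ring_of_type_algebra = (UNIV :: 'a set)"
  by (simp_all add: ring_of_type_algebra_def)

lemma type_algebra_uminus [simp]: "\<ominus>\<^bsub>ring_of_type_algebra\<^esub> a = (- a :: 'a::field)"
proof -
  interpret field "ring_of_type_algebra :: 'a ring" by (rule field_from_type_algebra)
  show ?thesis using minus_equality[of "- a" a] by simp
qed

lemma type_algebra_inverse: "a \<noteq> 0 \<Longrightarrow> inv\<^bsub>ring_of_type_algebra\<^esub> a = (inverse a :: 'a::field)"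
proof -
  assume "a \<noteq> 0"
  interpret field "ring_of_type_algebra :: 'a ring" by (rule field_from_type_algebra)
  show ?thesis using comm_inv_char[of a "inverse a"] \<open>a \<noteq> 0\<close> by simp
qed

lemma Q_adjoin_incl: "a \<in> S \<Longrightarrow> a \<in> Q_adjoin S"
  unfolding Q_adjoin_def by (rule generate_field.incl)

interpretation Q_adjoin: type_subfield "Q_adjoin S" for S
proof
  let ?R = "ring_of_type_algebra :: 'a ring"
  show one: "1 \<in> Q_adjoin S"
    using generate_field.one[of ?R S] by (simp add: Q_adjoin_def)
  show um: "- a \<in> Q_adjoin S" if "a \<in> Q_adjoin S" for a
    using generate_field.a_inv[of a ?R S] that by (simp add: Q_adjoin_def)
  show add: "a + b \<in> Q_adjoin S" if "a \<in> Q_adjoin S" "b \<in> Q_adjoin S" for a b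
    using generate_field.eng_add[of a ?R S b] that by (simp add: Q_adjoin_def)
  show "a * b \<in> Q_adjoin S" if "a \<in> Q_adjoin S" "b \<in> Q_adjoin S" for a b
    using generate_field.eng_mult[of a ?R S b] that by (simp add: Q_adjoin_def)
  show zero: "0 \<in> Q_adjoin S" using add[OF one um[OF one]] by simp
  show "inverse a \<in> Q_adjoin S" if "a \<in> Q_adjoin S" for a
    using generate_field.m_inv[of a ?R S] that zero
    by (cases "a = 0") (simp_all add: Q_adjoin_def type_algebra_inverse)
qed

lemma Q_adjoin_induct [consumes 1, case_names one incl uminus inverse add mult]:
  assumes "a \<in> Q_adjoin S"
    and "P 1" "\<And>s. s \<in> S \<Longrightarrow> P s"
    and "\<And>a. a \<in> Q_adjoin S \<Longrightarrow> P a \<Longrightarrow> P (- a)"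
    and "\<And>a. a \<in> Q_adjoin S \<Longrightarrow> a \<noteq> 0 \<Longrightarrow> P a \<Longrightarrow> P (inverse a)"
    and "\<And>a b. a \<in> Q_adjoin S \<Longrightarrow> P a \<Longrightarrow> b \<in> Q_adjoin S \<Longrightarrow> P b \<Longrightarrow> P (a + b)"
    and "\<And>a b. a \<in> Q_adjoin S \<Longrightarrow> P a \<Longrightarrow> b \<in> Q_adjoin S \<Longrightarrow> P b \<Longrightarrow> P (a * b)"
  shows "P a"
  using assms(1) unfolding Q_adjoin_def
  by (induction rule: generate_field.induct)
     (use assms(2-) in \<open>auto simp: Q_adjoin_def type_algebra_inverse\<close>)

lemma Q_adjoin_least:
  assumes "type_subfield K" "S \<subseteq> K"
  shows "Q_adjoin S \<subseteq> K"
proof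
  interpret type_subfield K by fact
  fix a assume "a \<in> Q_adjoin S"
  thus "a \<in> K"
    by (induction rule: Q_adjoin_induct)
       (use assms(2) in \<open>auto intro: add_mem mult_mem uminus_mem inverse_mem\<close>)
qed

lemma Q_adjoin_mono: "S \<subseteq> T \<Longrightarrow> Q_adjoin S \<subseteq> Q_adjoin T"
  by (rule Q_adjoin_least) (auto intro: Q_adjoin_incl Q_adjoin.type_subfield_axioms)

text \<open>
  A homomorphism on \<open>\<rat>(S)\<close> is determined by its values on \<open>S\<close>.
\<close>

lemma hom_eq_on_Q_adjoin:
  assumes "subfield_hom (Q_adjoin S) \<phi>" "subfield_hom (Q_adjoin S) \<psi>"
    and "\<And>s. s \<in> S \<Longrightarrow> \<phi> s = \<psi> s" "a \<in> Q_adjoin S"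
  shows "\<phi> a = \<psi> a"
proof -
  interpret f: subfield_hom "Q_adjoin S" \<phi> by fact
  interpret g: subfield_hom "Q_adjoin S" \<psi> by fact
  from assms(4) show ?thesis
    by (induction rule: Q_adjoin_induct)
       (simp_all add: assms(3) f.hom_add f.hom_mult g.hom_add g.hom_mult f.hom_uminus
         g.hom_uminus f.hom_inverse g.hom_inverse)
qed

lemma subfield_hom_subset:
  assumes "subfield_hom L \<phi>" "type_subfield K" "K \<subseteq> L"
  shows "subfield_hom K \<phi>"
proof -
  interpret subfield_hom L \<phi> by fact
  interpret K: type_subfield K by fact
  show ?thesis using assms(3) by unfold_locales (auto intro: hom_add hom_mult)
qed

lemma type_subfield_image:
  assumes "subfield_hom K \<phi>"
  shows "type_subfield (\<phi> ` K)"
proof -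
  interpret subfield_hom K \<phi> by fact
  show ?thesis
  proof
    show "0 \<in> \<phi> ` K" "1 \<in> \<phi> ` K" by (rule image_eqI[of _ _ 0] image_eqI[of _ _ 1]; simp)+
  qed (auto simp flip: hom_add hom_mult hom_uminus hom_inverse
         intro!: imageI add_mem mult_mem uminus_mem inverse_mem)
qed

lemma image_Q_adjoin:
  assumes "subfield_hom (Q_adjoin S) \<phi>"
  shows "\<phi> ` Q_adjoin S = Q_adjoin (\<phi> ` S)"
proof
  interpret subfield_hom "Q_adjoin S" \<phi> by fact
  show "\<phi> ` Q_adjoin S \<subseteq> Q_adjoin (\<phi> ` S)"
  proof safe
    fix a assume "a \<in> Q_adjoin S"
    thus "\<phi> a \<in> Q_adjoin (\<phi> ` S)"
      by (induction rule: Q_adjoin_induct)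
         (auto simp: hom_add hom_mult hom_uminus hom_inverse
           intro: Q_adjoin_incl Q_adjoin.add_mem Q_adjoin.mult_mem Q_adjoin.uminus_mem Q_adjoin.inverse_mem)
  qed
  show "Q_adjoin (\<phi> ` S) \<subseteq> \<phi> ` Q_adjoin S"
    by (rule Q_adjoin_least[OF type_subfield_image[OF assms]]) (auto intro: Q_adjoin_incl)
qed

lemma subfield_hom_inv_into:
  assumes "subfield_hom K \<phi>"
  shows "subfield_hom (\<phi> ` K) (inv_into K \<phi>)"
proof -
  interpret subfield_hom K \<phi> by fact
  interpret I: type_subfield "\<phi> ` K" by (rule type_subfield_image) fact
  have inv: "inv_into K \<phi> (\<phi> a) = a" if "a \<in> K" for a
    using that hom_inj by simp
  show ?thesis
  proof
    show "inv_into K \<phi> 1 = 1" using inv[of 1] by simp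
  qed (auto simp: inv add_mem mult_mem simp flip: hom_add hom_mult)
qed

text \<open>
  The prime fields of two fields of characteristic 0 are both copies of \<open>\<rat>\<close>.
\<close>

lemma Q_adjoin_empty_hom:
  "\<exists>\<psi>. subfield_hom (Q_adjoin {} :: 'a::field_char_0 set) (\<psi> :: 'a \<Rightarrow> 'b::field_char_0)"
proof -
  have r1: "subfield_hom UNIV (of_rat :: rat \<Rightarrow> 'a)" and r2: "subfield_hom UNIV (of_rat :: rat \<Rightarrow> 'b)"
    by (unfold_locales; simp add: of_rat_add of_rat_mult)+
  have "subfield_hom (range of_rat) (inv_into UNIV (of_rat :: rat \<Rightarrow> 'a))"
    by (rule subfield_hom_inv_into[OF r1])
  from subfield_hom_comp[OF this r2] 
  have "subfield_hom (range of_rat) (\<lambda>a. of_rat (inv_into UNIV (of_rat :: rat \<Rightarrow> 'a) a) :: 'b)" by simp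
  moreover have "Q_adjoin {} \<subseteq> (range of_rat :: 'a set)"
    by (rule Q_adjoin_least[OF type_subfield_image[OF r1]]) simp
  ultimately show ?thesis
    using subfield_hom_subset Q_adjoin.type_subfield_axioms by blast
qed

text \<open>
  A homomorphism \<open>\<psi>\<close> on \<open>K = \<rat>(S)\<close> extends to \<open>K(y)\<close> with \<open>y \<mapsto> z\<close> if the polynomials over \<open>K\<close> that vanish
  at \<open>y\<close> are those whose images under \<open>\<psi>\<close> vanish at \<open>z\<close>. This covers algebraic and transcendental
  \<open>y\<close> alike, since the elements of \<open>K(y)\<close> are written as quotients of polynomials in \<open>y\<close>.
\<close>

lemma extend_hom:
  fixes y :: "'a::field_char_0" and z :: "'b::field"
  assumes "subfield_hom (Q_adjoin S) \<psi>"
    and vanish: "\<And>q. q \<in> type_subfield.polys (Q_adjoin S) \<Longrightarrow>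
                   poly q y = 0 \<longleftrightarrow> poly (map_poly \<psi> q) z = 0"
  shows "\<exists>\<chi>. subfield_hom (Q_adjoin (insert y S)) \<chi> \<and> \<chi> y = z \<and> (\<forall>a\<in>Q_adjoin S. \<chi> a = \<psi> a)"
proof -
  interpret subfield_hom "Q_adjoin S" \<psi> by fact
  let ?P = "Q_adjoin.polys S"
  let ?ev = "\<lambda>q. poly (map_poly \<psi> q) z"
  define \<chi> where "\<chi> a = (SOME b. \<exists>p\<in>?P. \<exists>q\<in>?P. poly q y \<noteq> 0 \<and> a = poly p y / poly q y \<and>
                                  b = ?ev p / ?ev q)" for a
  have \<chi>: "\<chi> (poly p y / poly q y) = ?ev p / ?ev q"
    if pq: "p \<in> ?P" "q \<in> ?P" "poly q y \<noteq> 0" for p q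
  proof -
    have "\<exists>p'\<in>?P. \<exists>q'\<in>?P. poly q' y \<noteq> 0 \<and> poly p y / poly q y = poly p' y / poly q' y \<and>
            \<chi> (poly p y / poly q y) = ?ev p' / ?ev q'"
      unfolding \<chi>_def by (rule someI_ex) (use pq in blast)
    then obtain p' q' where *: "p' \<in> ?P" "q' \<in> ?P" "poly q' y \<noteq> 0"
      "poly p y / poly q y = poly p' y / poly q' y" "\<chi> (poly p y / poly q y) = ?ev p' / ?ev q'"
      by blast
    have "poly (p * q' - p' * q) y = 0" using * pq by (simp add: field_simps)
    hence "?ev (p * q' - p' * q) = 0"
      using * pq by (subst (asm) vanish) (auto intro: Q_adjoin.polys_diff Q_adjoin.polys_mult)
    hence "?ev p * ?ev q' = ?ev p' * ?ev q"
      using * pq by (simp add: map_poly_diff_hom map_poly_mult_hom Q_adjoin.polys_mult)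
    moreover have "?ev q \<noteq> 0" "?ev q' \<noteq> 0" using vanish[of q] vanish[of q'] * pq by auto
    ultimately have "?ev p / ?ev q = ?ev p' / ?ev q'" by (simp add: field_simps)
    thus ?thesis using *(5) by simp
  qed
  define frac where "frac a \<longleftrightarrow> (\<exists>p\<in>?P. \<exists>q\<in>?P. poly q y \<noteq> 0 \<and> a = poly p y / poly q y)" for a
  have fracI: "frac (poly p y / poly q y)" if "p \<in> ?P" "q \<in> ?P" "poly q y \<noteq> 0" for p q
    using that unfolding frac_def by blast
  have fracI1: "frac (poly p y)" if "p \<in> ?P" for p
    using fracI[of p 1] that by simp
  have frac_mem: "frac a" if "a \<in> Q_adjoin (insert y S)" for a
    using that
  proof (induction rule: Q_adjoin_induct)
    case one
    then show ?case using fracI1[of 1] by simp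
  next
    case (incl s)
    have "frac y" using fracI1[of "[:0, 1:]"] by (simp add: Q_adjoin.polys_pCons)
    moreover have "frac s" if "s \<in> S"
      using fracI1[of "[:s:]"] that by (simp add: Q_adjoin.polys_pCons Q_adjoin_incl)
    ultimately show ?case using incl by auto
  next
    case (uminus a)
    then obtain p q where pq: "p \<in> ?P" "q \<in> ?P" "poly q y \<noteq> 0" "a = poly p y / poly q y"
      unfolding frac_def by blast
    then show ?case using fracI[of "- p" q] by (simp add: Q_adjoin.polys_uminus)
  next
    case (inverse a)
    then obtain p q where pq: "p \<in> ?P" "q \<in> ?P" "poly q y \<noteq> 0" "a = poly p y / poly q y"
      unfolding frac_def by blast
    then show ?case using fracI[of q p] inverse by simp
  next
    case (add a b)
    then obtain p q p' q' where pq: "p \<in> ?P" "q \<in> ?P" "poly q y \<noteq> 0" "a = poly p y / poly q y"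
      "p' \<in> ?P" "q' \<in> ?P" "poly q' y \<noteq> 0" "b = poly p' y / poly q' y"
      unfolding frac_def by blast
    have "frac (poly (p * q' + p' * q) y / poly (q * q') y)"
      by (rule fracI) (simp_all add: pq Q_adjoin.polys_add Q_adjoin.polys_mult)
    moreover have "a + b = poly (p * q' + p' * q) y / poly (q * q') y"
      unfolding pq(4,8) using pq(3,7) by (simp add: field_simps)
    ultimately show ?case by (simp only:)
  next
    case (mult a b)
    then obtain p q p' q' where pq: "p \<in> ?P" "q \<in> ?P" "poly q y \<noteq> 0" "a = poly p y / poly q y"
      "p' \<in> ?P" "q' \<in> ?P" "poly q' y \<noteq> 0" "b = poly p' y / poly q' y"
      unfolding frac_def by blast
    then show ?case using fracI[of "p * p'" "q * q'"]
      by (simp add: Q_adjoin.polys_mult)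
  qed
  have "subfield_hom (Q_adjoin (insert y S)) \<chi>"
  proof
    show "\<chi> 1 = 1" using \<chi>[of 1 1] by simp
  next
    fix a b assume "a \<in> Q_adjoin (insert y S)" "b \<in> Q_adjoin (insert y S)"
    with frac_mem[of a] frac_mem[of b]
    obtain p q p' q' where pq: "p \<in> ?P" "q \<in> ?P" "poly q y \<noteq> 0" "a = poly p y / poly q y"
      "p' \<in> ?P" "q' \<in> ?P" "poly q' y \<noteq> 0" "b = poly p' y / poly q' y"
      unfolding frac_def by blast
    have nz: "?ev q \<noteq> 0" "?ev q' \<noteq> 0" using vanish[of q] vanish[of q'] pq by auto
    have \<chi>a: "\<chi> a = ?ev p / ?ev q" and \<chi>b: "\<chi> b = ?ev p' / ?ev q'"
      unfolding pq(4,8) using pq by (simp_all add: \<chi>)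
    have "a + b = poly (p * q' + p' * q) y / poly (q * q') y"
      unfolding pq(4,8) using pq(3,7) by (simp add: field_simps)
    hence "\<chi> (a + b) = ?ev (p * q' + p' * q) / ?ev (q * q')"
      using \<chi>[of "p * q' + p' * q" "q * q'"] pq by (simp only:) (simp add: Q_adjoin.polys_add Q_adjoin.polys_mult)
    also have "\<dots> = \<chi> a + \<chi> b"
      unfolding \<chi>a \<chi>b using pq nz
      by (simp add: map_poly_add_hom map_poly_mult_hom Q_adjoin.polys_mult field_simps)
    finally show "\<chi> (a + b) = \<chi> a + \<chi> b" .
    have "a * b = poly (p * p') y / poly (q * q') y"
      unfolding pq(4,8) using pq(3,7) by (simp add: field_simps)
    hence "\<chi> (a * b) = ?ev (p * p') / ?ev (q * q')"
      using \<chi>[of "p * p'" "q * q'"] pq by (simp only:) (simp add: Q_adjoin.polys_mult)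
    also have "\<dots> = \<chi> a * \<chi> b"
      using pq nz by (simp add: \<chi> map_poly_mult_hom)
    finally show "\<chi> (a * b) = \<chi> a * \<chi> b" .
  qed
  moreover have "\<chi> y = z"
    using \<chi>[of "[:0, 1:]" 1] by (simp add: Q_adjoin.polys_pCons map_poly_pCons_hom)
  moreover have "\<chi> a = \<psi> a" if "a \<in> Q_adjoin S" for a
    using \<chi>[of "[:a:]" 1] that by (simp add: Q_adjoin.polys_pCons map_poly_pCons_hom)
  ultimately show ?thesis by blast
qed


section \<open>Algebraic elements\<close>

interpretation Rats: type_subfield "\<rat> :: 'a::field_char_0 set"
  by unfold_locales auto

lemma algebraic_iff_Rats_polys:
  "Polynomial.algebraic (a :: 'a::field_char_0) \<longleftrightarrow> (\<exists>p\<in>Rats.polys. p \<noteq> 0 \<and> poly p a = 0)"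
  unfolding algebraic_altdef Rats.polys_def by auto

text \<open>
  If \<open>p(A(v)/B(v)) = 0\<close> with \<open>deg p = d\<close>, then \<open>v\<close> is a root of \<open>B\<^sup>d p(A/B)\<close>. As \<open>deg B < deg A\<close>, the
  terms of this polynomial have distinct degrees, so it does not vanish identically.
\<close>

lemma algebraic_if_quotient_algebraic:
  fixes v :: "'a::field_char_0"
  assumes A: "A \<in> Rats.polys" and B: "B \<in> Rats.polys"
    and deg: "degree B < degree A" and B0: "poly B v \<noteq> 0"
    and alg: "Polynomial.algebraic (poly A v / poly B v)"
  shows "Polynomial.algebraic v"
proof -
  obtain p where p: "p \<in> Rats.polys" "p \<noteq> 0" "poly p (poly A v / poly B v) = 0"
    using alg unfolding algebraic_iff_Rats_polys by blast
  define d where "d = degree p"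
  define q where "q = (\<Sum>i\<le>d. smult (coeff p i) (A ^ i * B ^ (d - i)))"
  have A0: "A \<noteq> 0" and Bn0: "B \<noteq> 0" using deg B0 by auto
  have "q \<in> Rats.polys"
    unfolding q_def
    by (intro Rats.polys_sum Rats.polys_smult Rats.polys_mult Rats.polys_power A B Rats.coeff_mem p)
  moreover have "poly q v = poly B v ^ d * poly p (poly A v / poly B v)"
    unfolding q_def poly_sum poly_altdef[of p] d_def[symmetric] sum_distrib_left
  proof (rule sum.cong)
    fix i assume "i \<in> {..d}"
    hence "poly B v ^ d = poly B v ^ i * poly B v ^ (d - i)" by (simp flip: power_add)
    thus "poly (smult (coeff p i) (A ^ i * B ^ (d - i))) v =
          poly B v ^ d * (coeff p i * (poly A v / poly B v) ^ i)"
      using B0 by (simp add: power_divide)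
  qed simp
  hence "poly q v = 0" using p by simp
  moreover have "coeff q (d * degree A) = coeff p d * lead_coeff A ^ d"
  proof -
    have "coeff (A ^ i * B ^ (d - i)) (d * degree A) = 0" if "i < d" for i
    proof (rule coeff_eq_0)
      have "(d - i) * degree B < (d - i) * degree A" using that deg by simp
      hence "i * degree A + (d - i) * degree B < (i + (d - i)) * degree A"
        unfolding add_mult_distrib by simp
      thus "degree (A ^ i * B ^ (d - i)) < d * degree A"
        using that A0 Bn0 by (simp add: degree_mult_eq degree_power_eq)
    qed
    hence "coeff q (d * degree A) = (\<Sum>i\<le>d. if i = d then coeff p d * coeff (A ^ d) (d * degree A) else 0)"
      unfolding q_def coeff_sum by (intro sum.cong) auto
    also have "\<dots> = coeff p d * coeff (A ^ d) (d * degree A)" by simp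
    also have "coeff (A ^ d) (d * degree A) = lead_coeff A ^ d"
      using A0 by (metis degree_power_eq lead_coeff_power)
    finally show ?thesis .
  qed
  hence "q \<noteq> 0" using p A0 by (auto simp: d_def)
  ultimately show ?thesis unfolding algebraic_iff_Rats_polys by blast
qed

text \<open>
  The powers of \<open>y\<close> lie in a vector space over \<open>\<rat>\<close> spanned by \<open>d\<close> of them, so the first \<open>d + 1\<close>
  powers of \<open>y\<^sup>k\<close> are linearly dependent.
\<close>

lemma algebraic_power:
  fixes y :: "'a::field_char_0"
  assumes "Polynomial.algebraic y"
  shows "Polynomial.algebraic (y ^ k)"
proof -
  interpret V: vector_space "\<lambda>r a. of_rat r * a :: 'a"
    by unfold_locales (auto simp: algebra_simps of_rat_add of_rat_mult)
  obtain p where p: "p \<in> Rats.polys" "p \<noteq> 0" "poly p y = 0"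
    using assms unfolding algebraic_iff_Rats_polys by blast
  define d where "d = degree p"
  define T where "T = (\<lambda>i. y ^ i) ` {..<d}"
  have cd: "coeff p d \<noteq> 0" using p by (simp add: d_def)
  have "(\<Sum>i\<le>d. coeff p i * y ^ i) = 0" using p by (simp add: poly_altdef d_def)
  hence "(\<Sum>i<d. coeff p i * y ^ i) + coeff p d * y ^ d = 0"
    by (simp add: lessThan_Suc_atMost[symmetric])
  hence "coeff p d * y ^ d = - (\<Sum>i<d. coeff p i * y ^ i)"
    by (simp add: eq_neg_iff_add_eq_0 add.commute)
  hence "y ^ d = - (\<Sum>i<d. coeff p i * y ^ i) / coeff p d"
    using cd by (metis nonzero_mult_div_cancel_left)
  hence yd: "y ^ d = (\<Sum>i<d. - (coeff p i / coeff p d) * y ^ i)"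
    by (simp add: sum_negf sum_divide_distrib)
  have span: "y ^ n \<in> V.span T" for n
  proof (induction n rule: less_induct)
    case (less n)
    show ?case
    proof (cases "n < d")
      case True
      thus ?thesis by (auto simp: T_def intro: V.span_base)
    next
      case False
      hence "y ^ n = y ^ (n - d) * y ^ d" by (simp flip: power_add)
      also have "\<dots> = (\<Sum>i<d. - (coeff p i / coeff p d) * y ^ (n - d + i))"
        unfolding yd by (simp add: sum_distrib_left power_add mult_ac)
      also have "\<dots> \<in> V.span T"
      proof (rule V.span_sum)
        fix i assume i: "i \<in> {..<d}"
        have "- (coeff p i / coeff p d) \<in> \<rat>"
          by (intro Rats.uminus_mem Rats.divide_mem Rats.coeff_mem p)
        then obtain r where r: "- (coeff p i / coeff p d) = of_rat r" by (meson Rats_cases)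
        show "- (coeff p i / coeff p d) * y ^ (n - d + i) \<in> V.span T"
          unfolding r by (rule V.span_scale, rule less.IH) (use i False in auto)
      qed
      finally show ?thesis .
    qed
  qed
  define z where "z = y ^ k"
  define S where "S = (\<lambda>i. z ^ i) ` {..d}"
  have z_span: "S \<subseteq> V.span T"
    using span by (auto simp: S_def z_def simp flip: power_mult)
  show ?thesis
    unfolding z_def[symmetric]
  \<comment> \<open>If two powers of \<open>z\<close> coincide, \<open>z\<close> is visibly algebraic; otherwise the dimension bound applies.\<close>
  proof (cases "inj_on (\<lambda>i. z ^ i) {..d}")
    case False
    then obtain i j where ij: "i \<noteq> j" "z ^ i = z ^ j" by (auto simp: inj_on_def)
    have "monom 1 i - monom 1 j \<in> Rats.polys"
      by (intro Rats.polys_diff Rats.polys_monom) auto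
    moreover have "monom 1 i - monom 1 j \<noteq> (0 :: 'a poly)" using ij by (simp add: monom_eq_iff')
    moreover have "poly (monom 1 i - monom 1 j) z = 0" using ij by (simp add: poly_monom)
    ultimately show "Polynomial.algebraic z" unfolding algebraic_iff_Rats_polys by blast
  next
    case True
    have "card T \<le> d" unfolding T_def using card_image_le[of "{..<d}"] by simp
    moreover have "card S = Suc d" unfolding S_def using True by (simp add: card_image)
    moreover have "finite T" by (simp add: T_def)
    ultimately have "V.dependent S"
      using V.independent_span_bound[of T S] z_span by auto
    moreover have "finite S" by (simp add: S_def)
    ultimately obtain u where u: "\<exists>v\<in>S. u v \<noteq> 0" "(\<Sum>v\<in>S. of_rat (u v) * v) = 0"
      using V.dependent_finite by auto
    define q where "q = (\<Sum>i\<le>d. monom (of_rat (u (z ^ i)) :: 'a) i)"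
    have "q \<in> Rats.polys"
      unfolding q_def by (intro Rats.polys_sum Rats.polys_monom) auto
    moreover have "poly q z = 0"
      using u(2) True unfolding S_def by (simp add: q_def poly_sum poly_monom sum.reindex)
    moreover have "coeff q i = (if i \<le> d then of_rat (u (z ^ i)) else 0)" for i
      by (simp add: q_def coeff_sum)
    hence "q \<noteq> 0" using u(1) by (auto simp: S_def poly_eq_iff)
    ultimately show "Polynomial.algebraic z" unfolding algebraic_iff_Rats_polys by blast
  qed
qed

section \<open>The equations (E) and (L)\<close>

lemma denominator_E_neq_0:
  fixes x :: "'a::field_char_0"
  assumes "\<not> Polynomial.algebraic x"
  shows "x^4 + x^3 + 6*x^2 + 6*x + 11 \<noteq> 0"
proof
  assume "x^4 + x^3 + 6*x^2 + 6*x + 11 = 0"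
  moreover have "poly [:11, 6, 6, 1, 1:] x = x^4 + x^3 + 6*x^2 + 6*x + 11" by (simp add: algebra_simps eval_nat_numeral)
  moreover have "[:11, 6, 6, 1, 1:] \<in> Rats.polys" by (simp add: Rats.polys_pCons)
  ultimately show False using assms unfolding algebraic_iff_Rats_polys
    by (metis pCons_eq_0_iff zero_neq_numeral)
qed

text \<open>
  Both sides become the same polynomial in \<open>v\<close> when \<open>v x\<close> is replaced by \<open>1 - v\<^sup>2\<close>.
\<close>

lemma quartics_product:
  fixes v :: "'a::field_char_0"
  assumes "v \<noteq> 0" "1 / v - v = x"
  shows "(v^4 - 3*v^3 + 4*v^2 - 2*v + 1) * (v^4 + 2*v^3 + 4*v^2 + 3*v + 1) =
         v^4 * (x^4 + x^3 + 6*x^2 + 6*x + 11)"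
proof -
  have *: "v * x = 1 - v^2" using assms by (auto simp: field_simps power2_eq_square)
  have "v^4 * (x^4 + x^3 + 6*x^2 + 6*x + 11) =
        (v*x)^4 + v*(v*x)^3 + 6*v^2*(v*x)^2 + 6*v^3*(v*x) + 11*v^4"
    by (simp add: algebra_simps eval_nat_numeral)
  thus ?thesis unfolding * by (simp add: algebra_simps eval_nat_numeral)
qed

lemma dickson_5:
  fixes w :: "'a::field_char_0"
  assumes "w \<noteq> 0" "1 / w - w = y"
  shows "y^5 + 5*y^3 + 5*y = 1 / w^5 - w^5"
  unfolding assms(2)[symmetric] using assms(1)
  by (simp add: field_simps eval_nat_numeral)

text \<open>
  With \<open>N D = v^4 F(x)\<close>, this amounts to the identity \<open>D\<^sup>2 - v\<^sup>2 N\<^sup>2 = (1 - v - v\<^sup>2)^5 + 11 v N D\<close>.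
\<close>

lemma quotient_L:
  fixes v :: "'a::field_char_0"
  defines "N \<equiv> v^4 - 3*v^3 + 4*v^2 - 2*v + 1"
    and "D \<equiv> v^4 + 2*v^3 + 4*v^2 + 3*v + 1"
  assumes nz: "v \<noteq> 0" "N \<noteq> 0" "D \<noteq> 0" and x: "1 / v - v = x"
  shows "1 / (v * (N / D)) - v * (N / D) = (x - 1)^5 / (x^4 + x^3 + 6*x^2 + 6*x + 11) + 11"
proof -
  define E where "E = x^4 + x^3 + 6*x^2 + 6*x + 11"
  have E: "N * D = v^4 * E"
    using quartics_product[OF nz(1) x] by (simp add: N_def D_def E_def)
  hence E0: "E \<noteq> 0" using nz by auto
  have *: "v * x = 1 - v^2" using nz x by (auto simp: field_simps power2_eq_square)
  have "D^2 - v^2 * N^2 = (1 - v - v^2)^5 + 11 * (v * (N * D))"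
    unfolding N_def D_def by (simp add: algebra_simps eval_nat_numeral)
  also have "1 - v - v^2 = v * (x - 1)" using * by (simp add: algebra_simps)
  also have "(v * (x - 1))^5 + 11 * (v * (N * D)) = v^5 * ((x - 1)^5 + 11 * E)"
    unfolding E by (simp add: algebra_simps eval_nat_numeral)
  finally have **: "D^2 - v^2 * N^2 = v^5 * ((x - 1)^5 + 11 * E)" .
  have "1 / (v * (N / D)) - v * (N / D) = (D^2 - v^2 * N^2) / (v * (N * D))"
    using nz by (simp add: field_simps power2_eq_square)
  also have "\<dots> = (v^5 * ((x - 1)^5 + 11 * E)) / (v^5 * E)"
    unfolding ** E by (simp add: eval_nat_numeral)
  also have "\<dots> = (x - 1)^5 / E + 11"
    using nz E0 by (simp add: add_divide_distrib)
  finally show ?thesis unfolding E_def .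
qed

lemma eq_L_imp_eq_E:
  fixes v w :: "'a::field_char_0"
  assumes "v \<noteq> 0" "v^4 - 3*v^3 + 4*v^2 - 2*v + 1 \<noteq> 0" "v^4 + 2*v^3 + 4*v^2 + 3*v + 1 \<noteq> 0"
    and L: "eq_L v w"
  shows "w \<noteq> 0" "eq_E (1 / v - v) (1 / w - w)"
proof -
  show w: "w \<noteq> 0"
    using assms unfolding eq_L_def by auto
  show "eq_E (1 / v - v) (1 / w - w)"
    unfolding eq_E_def dickson_5[OF w refl] using L[unfolded eq_L_def] quotient_L[OF assms(1-3) refl]
    by simp
qed

text \<open>
  Modulo \<open>w\<^sup>2 + y w - 1\<close>, \<open>w^5\<close> is \<open>a w - b\<close> with \<open>a = y^4 + 3 y\<^sup>2 + 1\<close> and \<open>b = y\<^sup>3 + 2 y\<close>. Conversely, if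
  \<open>1/W - W\<close> is as stated, the solution \<open>w\<close> of \<open>a w - b = W\<close> satisfies \<open>w\<^sup>2 + y w - 1 = 0\<close>.
\<close>

lemma quintic_root:
  fixes y W :: "'a::field"
  assumes a: "y^4 + 3*y^2 + 1 \<noteq> 0" and W: "W \<noteq> 0" "1 / W - W = y^5 + 5*y^3 + 5*y"
  defines "w \<equiv> (W + y^3 + 2*y) / (y^4 + 3*y^2 + 1)"
  shows "w \<noteq> 0" "1 / w - w = y" "w^5 = W"
proof -
  define a where "a = y^4 + 3*y^2 + 1"
  define b where "b = y^3 + 2*y"
  have w: "a * w = W + b" using a by (simp add: w_def a_def b_def)
  have W2: "W^2 = 1 - (y^5 + 5*y^3 + 5*y) * W"
    using W by (simp add: field_simps power2_eq_square)
  have "a^2 * (w^2 + y * w - 1) = (a*w)^2 + y*a*(a*w) - a^2"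
    by (simp add: algebra_simps power2_eq_square)
  also have "\<dots> = W^2 + (2*b + y*a)*W + (b^2 + y*a*b - a^2)"
    unfolding w by (simp add: algebra_simps power2_eq_square)
  also have "2*b + y*a = y^5 + 5*y^3 + 5*y"
    by (simp add: a_def b_def algebra_simps eval_nat_numeral)
  also have "b^2 + y*a*b - a^2 = -1"
    by (simp add: a_def b_def algebra_simps eval_nat_numeral)
  finally have "a^2 * (w^2 + y * w - 1) = 0" unfolding W2 by simp
  hence "w^2 + y * w - 1 = 0" using a unfolding a_def by simp
  hence w2: "w^2 = 1 - y * w" by (simp add: algebra_simps)
  thus w0: "w \<noteq> 0" by auto
  thus "1 / w - w = y" using w2 by (simp add: field_simps power2_eq_square)
  have "w^3 = w * w^2" by (simp add: power2_eq_square power3_eq_cube)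
  also have "\<dots> = w - y * w^2" by (subst w2) (simp add: algebra_simps power2_eq_square)
  also have "\<dots> = (1 + y^2) * w - y" unfolding w2 by (simp add: algebra_simps power2_eq_square)
  finally have w3: "w^3 = (1 + y^2) * w - y" .
  have "w^5 = w^2 * w^3" by (simp flip: power_add)
  also have "\<dots> = (1 + y^2) * w - y - y * (1 + y^2) * w^2 + y^2 * w"
    unfolding w3 by (subst w2) (simp add: algebra_simps power2_eq_square)
  also have "\<dots> = a * w - b"
    unfolding w2 by (simp add: a_def b_def algebra_simps eval_nat_numeral)
  finally show "w^5 = W" using w by simp
qed


section \<open>The tower in Laurent series\<close>

text \<open>
  The solution \<open>s\<close> of (E) near infinity: in terms of \<open>s = 1/x\<close> and \<open>t = 1/y\<close>, equation (E) reads
  \<open>A(s) = B(t)\<close> with \<open>A = s (1 + s + 6s\<^sup>2 + 6s\<^sup>3 + 11s^4)/(1 - s)^5\<close> and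
  \<open>B = t^5/(1 + 5t\<^sup>2 + 5t^4 - 11t^5)\<close>. As \<open>A\<close> has order 1, it has a compositional inverse.
\<close>

definition local_expansion :: "rat fps" where
  "local_expansion =
     fps_inv (fps_X * (1 + fps_X + 6*fps_X^2 + 6*fps_X^3 + 11*fps_X^4) * inverse ((1 - fps_X)^5))
     oo (fps_X^5 * inverse (1 + 5*fps_X^2 + 5*fps_X^4 - 11*fps_X^5))"

lemma local_expansion:
  shows "local_expansion $ 0 = 0" "subdegree local_expansion = 5"
    and "local_expansion * (1 + local_expansion + 6*local_expansion^2 + 6*local_expansion^3
           + 11*local_expansion^4) * (1 + 5*fps_X^2 + 5*fps_X^4 - 11*fps_X^5)
         = fps_X^5 * (1 - local_expansion)^5"
proof -
  define A :: "rat fps" where "A = fps_X * (1 + fps_X + 6*fps_X^2 + 6*fps_X^3 + 11*fps_X^4) * inverse ((1 - fps_X)^5)"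
  define U :: "rat fps" where "U = 1 + 5*fps_X^2 + 5*fps_X^4 - 11*fps_X^5"
  define B where "B = fps_X^5 * inverse U"
  define s where "s = local_expansion"
  have s: "s = fps_inv A oo B"
    by (simp add: s_def local_expansion_def A_def B_def U_def)
  have U0: "U $ 0 = 1" by (simp add: U_def fps_numeral_nth)
  have B0: "B $ 0 = 0" by (simp add: B_def)
  have A0: "A $ 0 = 0" by (simp add: A_def)
  have A1: "A $ 1 = 1" by (simp add: A_def fps_mult_nth_1 fps_numeral_nth fps_nth_power_0)
  have invA0: "fps_inv A $ 0 = 0" by (simp add: fps_inv_def)
  show s0: "local_expansion $ 0 = 0" using invA0 unfolding s_def[symmetric] s by simp
  have "A oo s = (A oo fps_inv A) oo B"
    unfolding s using B0 invA0 by (simp add: fps_compose_assoc)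
  also have "A oo fps_inv A = fps_X" using A0 A1 by (intro fps_inv_right) auto
  also have "fps_X oo B = B" using B0 by simp
  finally have AB: "A oo s = B" .
  have "subdegree A = 1" using A0 A1 by (intro subdegreeI) auto
  moreover have "subdegree B = 5"
    unfolding B_def using U0 by (subst subdegree_mult) auto
  ultimately show "subdegree local_expansion = 5"
    using AB s0 subdegree_fps_compose[of s A] by (simp add: s_def)
  have "A * (1 - fps_X)^5 = fps_X * (1 + fps_X + 6*fps_X^2 + 6*fps_X^3 + 11*fps_X^4)"
    unfolding A_def by (simp add: mult.assoc inverse_mult_eq_1)
  hence "(A * (1 - fps_X)^5) oo s = (fps_X * (1 + fps_X + 6*fps_X^2 + 6*fps_X^3 + 11*fps_X^4)) oo s"
    by simp
  hence "B * (1 - s)^5 = s * (1 + s + 6*s^2 + 6*s^3 + 11*s^4)"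
    using s0 AB by (simp add: s_def[symmetric] fps_compose_mult_distrib fps_compose_add_distrib
      fps_compose_sub_distrib fps_compose_power[symmetric])
  moreover have "B * U = fps_X^5"
    unfolding B_def using U0 by (simp add: mult.assoc inverse_mult_eq_1)
  ultimately have "s * (1 + s + 6*s^2 + 6*s^3 + 11*s^4) * U = fps_X^5 * (1 - s)^5"
    by (metis mult.assoc mult.commute)
  thus "local_expansion * (1 + local_expansion + 6*local_expansion^2 + 6*local_expansion^3
           + 11*local_expansion^4) * (1 + 5*fps_X^2 + 5*fps_X^4 - 11*fps_X^5)
         = fps_X^5 * (1 - local_expansion)^5"
    by (simp add: s_def U_def)
qed

text \<open>
  The endomorphism of \<open>\<rat>((t))\<close> that substitutes the solution \<open>s(t)\<close> for \<open>t\<close>. If \<open>1/t\<close> stands for the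
  last element of a sequence satisfying (E), the image of \<open>1/t\<close> stands for the one before it.
\<close>

definition tower_shift :: "rat fls \<Rightarrow> rat fls" where
  "tower_shift f = fls_compose_fps f local_expansion"

lemma local_expansion_nz: "local_expansion \<noteq> 0"
  using local_expansion(2) by auto

lemma subfield_hom_tower_shift: "subfield_hom UNIV tower_shift"
  by unfold_locales
     (simp_all add: tower_shift_def fls_compose_fps_add fls_compose_fps_mult local_expansion_nz local_expansion(1))

lemma subdegree_tower_shift: "fls_subdegree (tower_shift f) = fls_subdegree f * 5"
  by (simp add: tower_shift_def local_expansion)

lemma fls_X_inv_eq: "fls_X_inv = (1 / fls_X :: rat fls)"
proof -
  have "fls_X_inv * fls_X = (1 :: rat fls)" by (simp add: fls_X_inv_times_conv_shift)
  thus ?thesis by (metis fls_X_nonzero nonzero_eq_divide_eq)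
qed

lemma eq_E_tower_shift: "eq_E (tower_shift fls_X_inv) fls_X_inv"
proof -
  define S where "S = fps_to_fls local_expansion"
  define t where "t = (fls_X :: rat fls)"
  interpret subfield_hom UNIV tower_shift by (rule subfield_hom_tower_shift)
  have S0: "S \<noteq> 0" using local_expansion_nz by (simp add: S_def)
  have t0: "t \<noteq> 0" by (simp add: t_def)
  have tower_shift: "tower_shift fls_X_inv = 1 / S"
  proof -
    have "tower_shift (1 / fls_X) = tower_shift 1 / tower_shift fls_X" by (rule hom_divide) simp_all
    thus ?thesis by (simp only: fls_X_inv_eq hom_one) (simp add: tower_shift_def S_def)
  qed
  have fls: "S * (1 + S + 6*S^2 + 6*S^3 + 11*S^4) * (1 + 5*t^2 + 5*t^4 - 11*t^5) = t^5 * (1 - S)^5"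
    using arg_cong[OF local_expansion(3), of fps_to_fls]
    by (simp add: S_def t_def fls_times_fps_to_fls fps_to_fls_power)
  define P where "P = 1 + 5*t^2 + 5*t^4 - 11*t^5"
  define V where "V = 1 + S + 6*S^2 + 6*S^3 + 11*S^4"
  have V0: "V \<noteq> 0"
  proof
    assume "V = 0"
    have "(1 + local_expansion + 6*local_expansion^2 + 6*local_expansion^3 + 11*local_expansion^4) $ 0 = 1"
      by (simp add: local_expansion(1) fps_numeral_nth fps_nth_power_0)
    moreover have "fps_to_fls (1 + local_expansion + 6*local_expansion^2 + 6*local_expansion^3 + 11*local_expansion^4) = V"
      by (simp add: V_def S_def fls_times_fps_to_fls fps_to_fls_power)
    ultimately show False using \<open>V = 0\<close> by (metis fps_to_fls_eq_0_iff fps_zero_nth zero_neq_one)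
  qed
  have "(1/t)^5 + 5*(1/t)^3 + 5*(1/t) - 11 = P / t^5"
    using t0 by (simp add: P_def field_simps eval_nat_numeral)
  also have "\<dots> = (1 - S)^5 / (S * V)"
    using fls t0 S0 V0 unfolding P_def[symmetric] V_def[symmetric] by (simp add: field_simps)
  also have "\<dots> = ((1 - S) / S)^5 / (V / S^4)"
    using S0 V0 by (simp add: power_divide eval_nat_numeral)
  also have "(1 - S) / S = 1 / S - 1" using S0 by (simp add: field_simps)
  also have "V / S^4 = (1/S)^4 + (1/S)^3 + 6*(1/S)^2 + 6*(1/S) + 11"
    using S0 by (simp add: V_def field_simps eval_nat_numeral)
  finally show ?thesis unfolding eq_E_def tower_shift unfolding fls_X_inv_eq t_def .
qed

text \<open>
  The term of least order cannot cancel.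
\<close>

lemma sum_fls_distinct_subdegrees:
  fixes f :: "'i \<Rightarrow> 'a::comm_monoid_add fls"
  assumes "finite I" "I \<noteq> {}" "\<And>i. i \<in> I \<Longrightarrow> f i \<noteq> 0" "inj_on (\<lambda>i. fls_subdegree (f i)) I"
  shows "sum f I \<noteq> 0"
proof -
  define j where "j = arg_min_on (\<lambda>i. fls_subdegree (f i)) I"
  have j: "j \<in> I" unfolding j_def using assms by (intro arg_min_if_finite)
  have le: "fls_subdegree (f j) \<le> fls_subdegree (f i)" if "i \<in> I" for i
    unfolding j_def using assms that by (intro arg_min_least) auto
  have "fls_nth (f i) (fls_subdegree (f j)) = 0" if "i \<in> I" "i \<noteq> j" for i
    using le[of i] that j assms(4) by (intro fls_eq0_below_subdegree) (auto simp: inj_on_def le_less)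
  hence "fls_nth (sum f I) (fls_subdegree (f j)) = fls_nth (f j) (fls_subdegree (f j))"
    using j assms(1) by (simp add: fls_nth_sum sum.remove)
  also have "\<dots> \<noteq> 0" using assms(3)[OF j] by simp
  finally show ?thesis by auto
qed

lemma poly_fls_X_inv_neq_0:
  fixes r :: "'a::field fls poly"
  assumes "r \<noteq> 0"
    and inj: "inj_on (\<lambda>i. fls_subdegree (coeff r i) - int i) {i. coeff r i \<noteq> 0}"
  shows "poly r fls_X_inv \<noteq> 0"
proof -
  let ?I = "{i. coeff r i \<noteq> 0}"
  have I: "?I \<subseteq> {..degree r}" by (auto intro: le_degree)
  have fin: "finite ?I" using I finite_subset by blast
  have "poly r fls_X_inv = (\<Sum>i\<in>?I. coeff r i * fls_X_inv ^ i)"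
    unfolding poly_altdef using I by (intro sum.mono_neutral_right) auto
  also have "\<dots> \<noteq> 0"
  proof (rule sum_fls_distinct_subdegrees)
    have "degree r \<in> ?I" using assms by auto
    thus "?I \<noteq> {}" by blast
    show "inj_on (\<lambda>i. fls_subdegree (coeff r i * fls_X_inv ^ i)) ?I"
      using inj by (rule inj_on_cong[THEN iffD1, rotated]) auto
  qed (use fin in auto)
  finally show ?thesis .
qed

lemma of_rat_fls: "(of_rat r :: 'a::field_char_0 fls) = fls_const (of_rat r)"
proof (cases r)
  case (Fract a b)
  then show ?thesis by (simp add: of_rat_rat fls_of_int fls_const_divide_const)
qed

lemma fls_subdegree_Rats: "c \<in> \<rat> \<Longrightarrow> fls_subdegree (c :: 'a::field_char_0 fls) = 0"
  by (auto elim!: Rats_cases simp: of_rat_fls)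

lemma transcendental_fls_X_inv: "\<not> Polynomial.algebraic (fls_X_inv :: 'a::field_char_0 fls)"
proof
  assume "Polynomial.algebraic (fls_X_inv :: 'a fls)"
  then obtain p :: "'a fls poly" where p: "p \<in> Rats.polys" "p \<noteq> 0" "poly p fls_X_inv = 0"
    unfolding algebraic_iff_Rats_polys by blast
  have "poly p fls_X_inv \<noteq> 0"
    by (rule poly_fls_X_inv_neq_0) (use p in \<open>auto simp: inj_on_def fls_subdegree_Rats Rats.coeff_mem\<close>)
  thus False using p by simp
qed

lemma fls_X_inv_degree_over_tower_shift:
  assumes "\<And>i. coeff r i \<in> range tower_shift" "degree r < 5" "poly r fls_X_inv = 0"
  shows "r = 0"
proof (rule ccontr)
  assume "r \<noteq> 0"
  \<comment> \<open>The coefficients have orders divisible by 5, so the orders of the terms are distinct modulo 5.\<close>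
  have "poly r fls_X_inv \<noteq> 0"
  proof (rule poly_fls_X_inv_neq_0[OF \<open>r \<noteq> 0\<close>], rule inj_onI)
    fix i j assume ij: "i \<in> {i. coeff r i \<noteq> 0}" "j \<in> {i. coeff r i \<noteq> 0}"
      "fls_subdegree (coeff r i) - int i = fls_subdegree (coeff r j) - int j"
    from assms(1)[of i] assms(1)[of j] obtain f g where "coeff r i = tower_shift f" "coeff r j = tower_shift g" by blast
    hence "fls_subdegree f * 5 - int i = fls_subdegree g * 5 - int j" using ij(3) by (simp add: subdegree_tower_shift)
    moreover have "i < 5" "j < 5" using ij assms(2) le_degree[of r i] le_degree[of r j] by auto
    ultimately show "i = j" by presburger
  qed
  thus False using assms by simp
qed

text \<open>
  In the induction step the embedding of \<open>\<rat>(x\<^sub>0,\<dots>,x\<^sub>n)\<close> is composed with \<^const>\<open>tower_shift\<close>, which makes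
  room for the image \<open>1/t\<close> of \<open>x\<^sub>n\<^sub>+\<^sub>1\<close>.
\<close>

lemma embed_in_laurent_series:
  assumes "recursive_sequence eq_E n (x :: nat \<Rightarrow> 'a::field_char_0)"
  shows "\<exists>\<phi>. subfield_hom (Q_adjoin (x ` {..n})) \<phi> \<and> (\<forall>i\<le>n. \<phi> (x i) = (tower_shift ^^ (n - i)) fls_X_inv)"
  using assms
proof (induction n)
  case 0
  obtain \<psi> :: "'a \<Rightarrow> rat fls" where \<psi>: "subfield_hom (Q_adjoin {}) \<psi>"
    using Q_adjoin_empty_hom by blast
  interpret subfield_hom "Q_adjoin {}" \<psi> by (rule \<psi>)
  have Rat: "Q_adjoin {} \<subseteq> (\<rat> :: 'a set)"
    by (rule Q_adjoin_least[OF Rats.type_subfield_axioms]) simp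
  have Rat': "\<psi> ` Q_adjoin {} \<subseteq> \<rat>"
    unfolding image_Q_adjoin[OF \<psi>] by (rule Q_adjoin_least[OF Rats.type_subfield_axioms]) simp
  have "\<exists>\<chi>. subfield_hom (Q_adjoin (insert (x 0) {})) \<chi> \<and> \<chi> (x 0) = fls_X_inv \<and> (\<forall>a\<in>Q_adjoin {}. \<chi> a = \<psi> a)"
  proof (rule extend_hom[OF \<psi>])
    fix q :: "'a poly" assume q: "q \<in> Q_adjoin.polys {}"
    have "q \<in> Rats.polys" using subsetD[OF Rat Q_adjoin.coeff_mem[OF q]] by (auto simp: Rats.polys_def)
    moreover have "\<not> Polynomial.algebraic (x 0)" using 0 by (simp add: recursive_sequence_def)
    ultimately have 1: "poly q (x 0) = 0 \<longleftrightarrow> q = 0" by (auto simp: algebraic_iff_Rats_polys)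
    have "map_poly \<psi> q \<in> Rats.polys"
      using Rat' Q_adjoin.coeff_mem[OF q] by (auto simp: Rats.polys_def coeff_map)
    hence "poly (map_poly \<psi> q) fls_X_inv = 0 \<longleftrightarrow> map_poly \<psi> q = 0"
      using transcendental_fls_X_inv[where 'a=rat] by (auto simp: algebraic_iff_Rats_polys)
    thus "poly q (x 0) = 0 \<longleftrightarrow> poly (map_poly \<psi> q) fls_X_inv = 0"
      using 1 map_poly_eq_0_iff_hom[OF q] by simp
  qed
  thus ?case by auto
next
  case (Suc n)
  let ?K = "Q_adjoin (x ` {..n})"
  have "recursive_sequence eq_E n x" using Suc.prems by (simp add: recursive_sequence_def)
  from Suc.IH[OF this] obtain \<phi> where \<phi>: "subfield_hom ?K \<phi>" "\<And>i. i \<le> n \<Longrightarrow> \<phi> (x i) = (tower_shift ^^ (n - i)) fls_X_inv"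
    by blast
  define \<psi> where "\<psi> = (\<lambda>a. tower_shift (\<phi> a))"
  have \<psi>: "subfield_hom ?K \<psi>"
    unfolding \<psi>_def by (rule subfield_hom_comp[OF \<phi>(1) subfield_hom_tower_shift]) simp
  interpret subfield_hom ?K \<psi> by (rule \<psi>)
  have xn: "x n \<in> ?K" by (rule Q_adjoin_incl) simp
  define R where "R = (x n - 1)^5 / ((x n)^4 + (x n)^3 + 6*(x n)^2 + 6*(x n) + 11)"
  note mem = xn Q_adjoin.numeral_mem Q_adjoin.one_mem Q_adjoin.add_mem Q_adjoin.mult_mem
    Q_adjoin.diff_mem Q_adjoin.divide_mem Q_adjoin.power_mem Q_adjoin.uminus_mem
  have R: "R \<in> ?K"
    unfolding R_def by (intro mem)
  \<comment> \<open>Equation (E) for the unknown \<open>x (Suc n)\<close>.\<close>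
  define T where "T = [:-11 - R, 5, 0, 5, 0, 1:]"
  have T: "T \<in> Q_adjoin.polys (x ` {..n})" unfolding T_def by (intro Q_adjoin.polys_pCons mem R Q_adjoin.polys_0 Q_adjoin.zero_mem)
  have "eq_E (x n) (x (Suc n))" using Suc.prems by (simp add: recursive_sequence_def)
  hence Ty: "poly T (x (Suc n)) = 0"
    unfolding eq_E_def R_def[symmetric] by (simp add: T_def algebra_simps eval_nat_numeral)
  have "\<psi> (x n) = tower_shift fls_X_inv" using \<phi>(2)[of n] by (simp add: \<psi>_def)
  hence \<psi>R: "\<psi> R = (tower_shift fls_X_inv - 1)^5 / ((tower_shift fls_X_inv)^4 + (tower_shift fls_X_inv)^3 + 6*(tower_shift fls_X_inv)^2 + 6*(tower_shift fls_X_inv) + 11)"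
    unfolding R_def by (simp add: hom_add hom_mult hom_diff hom_divide hom_power mem)
  have "map_poly \<psi> T = [:-11 - \<psi> R, 5, 0, 5, 0, 1:]"
    by (simp add: T_def map_poly_pCons_hom hom_diff hom_uminus mem R)
  hence Tz: "poly (map_poly \<psi> T) fls_X_inv = 0"
    using eq_E_tower_shift unfolding eq_E_def \<psi>R[symmetric] by (simp add: algebra_simps eval_nat_numeral)
  have degT: "degree T = 5" by (simp add: T_def)
  have "\<exists>\<chi>. subfield_hom (Q_adjoin (insert (x (Suc n)) (x ` {..n}))) \<chi> \<and> \<chi> (x (Suc n)) = fls_X_inv
          \<and> (\<forall>a\<in>?K. \<chi> a = \<psi> a)"
  proof (rule extend_hom[OF \<psi>], rule vanish_iff[OF T _ Ty Tz])
    show "T \<noteq> 0" by (simp add: T_def)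
    fix r assume r: "r \<in> Q_adjoin.polys (x ` {..n})" "degree r < degree T" "poly (map_poly \<psi> r) fls_X_inv = 0"
    have "map_poly \<psi> r = 0"
      by (rule fls_X_inv_degree_over_tower_shift)
         (use r degT in \<open>simp_all add: degree_map_poly_hom coeff_map \<psi>_def[THEN fun_cong]\<close>)
    thus "r = 0" using map_poly_eq_0_iff_hom r by blast
  qed
  then obtain \<chi> where \<chi>: "subfield_hom (Q_adjoin (insert (x (Suc n)) (x ` {..n}))) \<chi>"
    "\<chi> (x (Suc n)) = fls_X_inv" "\<And>a. a \<in> ?K \<Longrightarrow> \<chi> a = \<psi> a" by blast
  have "\<chi> (x i) = (tower_shift ^^ (Suc n - i)) fls_X_inv" if "i \<le> Suc n" for i
  proof (cases "i = Suc n")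
    case False
    hence "i \<le> n" using that by simp
    moreover from this have "x i \<in> ?K" by (intro Q_adjoin_incl) auto
    ultimately show ?thesis using \<chi>(3) \<phi>(2) by (simp add: \<psi>_def Suc_diff_le)
  qed (simp add: \<chi>)
  with \<chi>(1) show ?case by (auto simp: atMost_Suc)
qed


section \<open>Comparison of the towers\<close>

lemma transcendental_quotient_L:
  fixes v :: "'a::field_char_0"
  assumes v: "\<not> Polynomial.algebraic v"
  shows "v \<noteq> 0" "v^4 - 3*v^3 + 4*v^2 - 2*v + 1 \<noteq> 0" "v^4 + 2*v^3 + 4*v^2 + 3*v + 1 \<noteq> 0"
    and "\<not> Polynomial.algebraic (v * ((v^4 - 3*v^3 + 4*v^2 - 2*v + 1) / (v^4 + 2*v^3 + 4*v^2 + 3*v + 1)))"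
    and "\<not> Polynomial.algebraic (1 / v - v)"
proof -
  define N where "N = [:1, -2, 4, -3, 1 :: 'a:]"
  define D where "D = [:1, 3, 4, 2, 1 :: 'a:]"
  have mem: "N \<in> Rats.polys" "D \<in> Rats.polys"
    by (simp_all add: N_def D_def Rats.polys_pCons)
  have N: "poly N v = v^4 - 3*v^3 + 4*v^2 - 2*v + 1"
    by (simp add: N_def algebra_simps eval_nat_numeral)
  have D: "poly D v = v^4 + 2*v^3 + 4*v^2 + 3*v + 1"
    by (simp add: D_def algebra_simps eval_nat_numeral)
  have nz: "poly p v \<noteq> 0" if "p \<in> Rats.polys" "p \<noteq> 0" for p
    using v that unfolding algebraic_iff_Rats_polys by blast
  show v0: "v \<noteq> 0" using v by auto
  show "v^4 - 3*v^3 + 4*v^2 - 2*v + 1 \<noteq> 0" unfolding N[symmetric] by (rule nz[OF mem(1)]) (simp add: N_def)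
  have Dv: "poly D v \<noteq> 0" by (rule nz[OF mem(2)]) (simp add: D_def)
  thus "v^4 + 2*v^3 + 4*v^2 + 3*v + 1 \<noteq> 0" unfolding D[symmetric] .
  have "\<not> Polynomial.algebraic (poly (pCons 0 N) v / poly D v)"
    using algebraic_if_quotient_algebraic[of "pCons 0 N" D v] mem Dv v
    by (auto simp: Rats.polys_pCons N_def D_def)
  thus "\<not> Polynomial.algebraic (v * ((v^4 - 3*v^3 + 4*v^2 - 2*v + 1) / (v^4 + 2*v^3 + 4*v^2 + 3*v + 1)))"
    by (simp add: N D)
  have "\<not> Polynomial.algebraic (poly [:1, 0, -1:] v / poly [:0, 1:] v)"
    using algebraic_if_quotient_algebraic[of "[:1, 0, -1:]" "[:0, 1:]" v] v0 v
    by (auto simp: Rats.polys_pCons)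
  moreover have "poly [:1, 0, -1:] v / poly [:0, 1:] v = 1 / v - v"
    using v0 by (simp add: field_simps)
  ultimately show "\<not> Polynomial.algebraic (1 / v - v)" by simp
qed

lemma transcendental_eq_L:
  fixes v w :: "'a::field_char_0"
  assumes "\<not> Polynomial.algebraic v" "eq_L v w"
  shows "\<not> Polynomial.algebraic w"
  using transcendental_quotient_L(4)[OF assms(1)] algebraic_power[of w 5] assms(2)
  unfolding eq_L_def by auto

lemma exists_root_in_adjunction:
  fixes x y v :: "'a::field_char_0"
  assumes x: "\<not> Polynomial.algebraic x" and E: "eq_E x y" and v: "1 / v - v = x"
  shows "\<exists>w \<in> Q_adjoin {v, y}. w \<noteq> 0 \<and> 1 / w - w = y \<and>
           w^5 = v * ((v^4 - 3*v^3 + 4*v^2 - 2*v + 1) / (v^4 + 2*v^3 + 4*v^2 + 3*v + 1))"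
proof -
  define N where "N = v^4 - 3*v^3 + 4*v^2 - 2*v + 1"
  define D where "D = v^4 + 2*v^3 + 4*v^2 + 3*v + 1"
  define F where "F = x^4 + x^3 + 6*x^2 + 6*x + 11"
  define W where "W = v * (N / D)"
  have v0: "v \<noteq> 0" using v x by auto
  have F0: "F \<noteq> 0" unfolding F_def by (rule denominator_E_neq_0[OF x])
  have "N * D \<noteq> 0"
    using quartics_product[OF v0 v] v0 F0 by (simp add: N_def D_def F_def)
  hence N0: "N \<noteq> 0" and D0: "D \<noteq> 0" by auto
  have W: "W \<noteq> 0" using v0 N0 D0 by (simp add: W_def)
  have Q: "1 / W - W = (x - 1)^5 / F + 11"
    unfolding W_def F_def N_def D_def
    by (rule quotient_L[OF v0 N0[unfolded N_def] D0[unfolded D_def] v])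
  have y: "y^5 + 5*y^3 + 5*y = (x - 1)^5 / F + 11"
    using E unfolding eq_E_def F_def by (simp add: algebra_simps)
  \<comment> \<open>Otherwise \<open>(y^5 + 5y\<^sup>3 + 5y)\<^sup>2 + 4 = (y\<^sup>2 + 4)(y^4 + 3y\<^sup>2 + 1)\<^sup>2\<close> vanishes, and \<open>x\<close> is algebraic by (E).\<close>
  have a0: "y^4 + 3*y^2 + 1 \<noteq> 0"
  proof
    assume a: "y^4 + 3*y^2 + 1 = 0"
    have "(y^5 + 5*y^3 + 5*y)^2 + 4 = (y^2 + 4) * (y^4 + 3*y^2 + 1)^2"
      by (simp add: algebra_simps eval_nat_numeral)
    hence "((x - 1)^5 / F + 11)^2 + 4 = 0" unfolding a y by simp
    hence "F^2 * (((x - 1)^5 / F + 11)^2 + 4) = 0" by simp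
    moreover have "F^2 * (((x - 1)^5 / F + 11)^2 + 4) = (F * ((x - 1)^5 / F + 11))^2 + 4 * F^2"
      by (simp add: algebra_simps power2_eq_square)
    moreover have "F * ((x - 1)^5 / F + 11) = (x - 1)^5 + 11 * F"
      using F0 by (simp add: algebra_simps)
    ultimately have root: "((x - 1)^5 + 11 * F)^2 + 4 * F^2 = 0" by simp
    define p where "p = [:11, 6, 6, 1, 1 :: 'a:]"
    define q where "q = ([:-1, 1:]^5 + smult 11 p)^2 + smult 4 (p^2)"
    have px: "poly p x = F" by (simp add: p_def F_def algebra_simps eval_nat_numeral)
    have "p \<in> Rats.polys" by (simp add: p_def Rats.polys_pCons)
    moreover have "[:-1, 1::'a:] \<in> Rats.polys" by (simp add: Rats.polys_pCons)
    ultimately have "q \<in> Rats.polys" unfolding q_def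
      by (intro Rats.polys_add Rats.polys_power Rats.polys_smult) auto
    moreover have "poly q x = ((x - 1)^5 + 11 * F)^2 + 4 * F^2"
      by (simp add: q_def px)
    moreover have "poly q 0 \<noteq> 0" by (simp add: q_def p_def)
    hence "q \<noteq> 0" by auto
    ultimately show False
      using x root unfolding algebraic_iff_Rats_polys by auto
  qed
  define w where "w = (W + y^3 + 2*y) / (y^4 + 3*y^2 + 1)"
  have "1 / W - W = y^5 + 5*y^3 + 5*y" unfolding y by (rule Q)
  from quintic_root[OF a0 W this]
  have "w \<noteq> 0" "1 / w - w = y" "w^5 = W" by (simp_all add: w_def)
  moreover have "v \<in> Q_adjoin {v, y}" "y \<in> Q_adjoin {v, y}" by (auto intro: Q_adjoin_incl)
  hence "w \<in> Q_adjoin {v, y}" unfolding w_def W_def N_def D_def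
    by (intro Q_adjoin.add_mem Q_adjoin.diff_mem Q_adjoin.mult_mem Q_adjoin.divide_mem
          Q_adjoin.power_mem Q_adjoin.numeral_mem Q_adjoin.one_mem)
  ultimately show ?thesis unfolding W_def N_def D_def by blast
qed

lemma recursive_sequence_transcendental:
  assumes "recursive_sequence eq_L n (v :: nat \<Rightarrow> 'a::field_char_0)" "i \<le> n"
  shows "\<not> Polynomial.algebraic (v i)"
  using assms(2)
proof (induction i)
  case (Suc i)
  then show ?case using transcendental_eq_L[of "v i" "v (Suc i)"] assms(1)
    by (simp add: recursive_sequence_def)
qed (use assms(1) in \<open>simp add: recursive_sequence_def\<close>)

lemma recursive_sequence_L_imp_E:
  assumes "recursive_sequence eq_L n (v :: nat \<Rightarrow> 'a::field_char_0)"
  shows "recursive_sequence eq_E n (\<lambda>i. 1 / v i - v i)"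
  unfolding recursive_sequence_def
proof (intro conjI allI impI)
  show "\<not> Polynomial.algebraic (1 / v 0 - v 0)"
    using transcendental_quotient_L(5) recursive_sequence_transcendental[OF assms] by blast
  fix i assume "i < n"
  hence "\<not> Polynomial.algebraic (v i)" "eq_L (v i) (v (Suc i))"
    using recursive_sequence_transcendental[OF assms, of i] assms by (auto simp: recursive_sequence_def)
  thus "eq_E (1 / v i - v i) (1 / v (Suc i) - v (Suc i))"
    using transcendental_quotient_L(1-3) eq_L_imp_eq_E(2) by blast
qed

lemma Q_adjoin_inverse_diff_subset:
  fixes v :: "nat \<Rightarrow> 'a::field_char_0"
  shows "Q_adjoin ((\<lambda>i. 1 / v i - v i) ` A) \<subseteq> Q_adjoin (v ` A)"
proof (rule Q_adjoin_least[OF Q_adjoin.type_subfield_axioms], safe)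
  fix i assume "i \<in> A"
  hence "v i \<in> Q_adjoin (v ` A)" by (intro Q_adjoin_incl) auto
  thus "1 / v i - v i \<in> Q_adjoin (v ` A)"
    by (intro Q_adjoin.diff_mem Q_adjoin.divide_mem Q_adjoin.one_mem)
qed

lemma eq_E_sequences_hom:
  assumes x: "recursive_sequence eq_E n (x :: nat \<Rightarrow> 'a::field_char_0)"
    and y: "recursive_sequence eq_E n (y :: nat \<Rightarrow> 'b::field_char_0)"
  shows "\<exists>\<theta>. subfield_hom (Q_adjoin (x ` {..n})) \<theta> \<and> (\<forall>i\<le>n. \<theta> (x i) = y i)"
proof -
  obtain \<phi> where \<phi>: "subfield_hom (Q_adjoin (x ` {..n})) \<phi>" "\<And>i. i \<le> n \<Longrightarrow> \<phi> (x i) = (tower_shift ^^ (n - i)) fls_X_inv"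
    using embed_in_laurent_series[OF x] by blast
  obtain \<psi> where \<psi>: "subfield_hom (Q_adjoin (y ` {..n})) \<psi>" "\<And>i. i \<le> n \<Longrightarrow> \<psi> (y i) = (tower_shift ^^ (n - i)) fls_X_inv"
    using embed_in_laurent_series[OF y] by blast
  interpret \<psi>: subfield_hom "Q_adjoin (y ` {..n})" \<psi> by (rule \<psi>)
  have "\<phi> ` x ` {..n} = \<psi> ` y ` {..n}"
    unfolding image_image using \<phi>(2) \<psi>(2) by (intro image_cong) auto
  hence im: "\<phi> ` Q_adjoin (x ` {..n}) = \<psi> ` Q_adjoin (y ` {..n})"
    using image_Q_adjoin[OF \<phi>(1)] image_Q_adjoin[OF \<psi>(1)] by simp
  let ?inv = "inv_into (Q_adjoin (y ` {..n})) \<psi>"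
  have "subfield_hom (Q_adjoin (x ` {..n})) (\<lambda>a. ?inv (\<phi> a))"
    by (rule subfield_hom_comp[OF \<phi>(1) subfield_hom_inv_into[OF \<psi>(1)]]) (simp add: im)
  moreover have "?inv (\<phi> (x i)) = y i" if "i \<le> n" for i
  proof -
    have "y i \<in> Q_adjoin (y ` {..n})" using that by (intro Q_adjoin_incl) auto
    thus ?thesis using \<phi>(2)[OF that] \<psi>(2)[OF that] \<psi>.hom_inj by (metis inv_into_f_f)
  qed
  ultimately show ?thesis by blast
qed

text \<open>
  By uniqueness, the homomorphisms of the levels agree where several of them are defined.
\<close>

lemma eq_E_tower_hom:
  assumes x: "\<And>n. recursive_sequence eq_E n (x :: nat \<Rightarrow> 'a::field_char_0)"
    and y: "\<And>n. recursive_sequence eq_E n (y :: nat \<Rightarrow> 'b::field_char_0)"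
  shows "\<exists>\<theta>. \<forall>n. subfield_hom (Q_adjoin (x ` {..n})) \<theta> \<and> (\<forall>i. \<theta> (x i) = y i)"
proof -
  let ?K = "\<lambda>n. Q_adjoin (x ` {..n})"
  have "\<exists>\<theta>. \<forall>n. subfield_hom (?K n) (\<theta> n) \<and> (\<forall>i\<le>n. \<theta> n (x i) = y i)"
    by (rule choice) (use eq_E_sequences_hom[OF x y] in blast)
  then obtain \<theta> where \<theta>: "\<And>n. subfield_hom (?K n) (\<theta> n)" "\<And>n i. i \<le> n \<Longrightarrow> \<theta> n (x i) = y i" by blast
  have mono: "?K m \<subseteq> ?K n" if "m \<le> n" for m n
    using that by (intro Q_adjoin_mono image_mono) auto
  have compat: "\<theta> n a = \<theta> m a" if "m \<le> n" "a \<in> ?K m" for m n a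
  proof (rule hom_eq_on_Q_adjoin[OF _ \<theta>(1) _ that(2)])
    show "subfield_hom (?K m) (\<theta> n)"
      by (rule subfield_hom_subset[OF \<theta>(1) Q_adjoin.type_subfield_axioms mono[OF that(1)]])
  qed (use that(1) in \<open>auto simp: \<theta>(2)\<close>)
  define \<Theta> where "\<Theta> a = \<theta> (LEAST n. a \<in> ?K n) a" for a
  have eq: "\<Theta> a = \<theta> n a" if "a \<in> ?K n" for a n
    unfolding \<Theta>_def
    using compat[of "LEAST n. a \<in> ?K n" n a] Least_le[of "\<lambda>n. a \<in> ?K n" n]
      LeastI[of "\<lambda>n. a \<in> ?K n" n] that by simp
  have "\<Theta> (x i) = y i" for i
    using eq[of "x i" i] \<theta>(2)[of i i] by (simp add: Q_adjoin_incl)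
  moreover have "subfield_hom (?K n) \<Theta>" for n
    by (rule subfield_hom_cong[OF \<theta>(1) eq])
  ultimately show ?thesis by blast
qed

lemma eq_L_tower_is_supertower:
  fixes F :: "nat \<Rightarrow> 'b::field_char_0 set" and G :: "nat \<Rightarrow> 'a::field_char_0 set"
  assumes "satisfies_recursive_equation F eq_E" "satisfies_recursive_equation G eq_L"
  shows "is_supertower G F"
proof -
  obtain x where x: "\<And>n. recursive_sequence eq_E n x" "\<And>n. F n = Q_adjoin (x ` {..n})"
    using assms(1) unfolding satisfies_recursive_equation_def by blast
  obtain v where v: "\<And>n. recursive_sequence eq_L n v" "\<And>n. G n = Q_adjoin (v ` {..n})"
    using assms(2) unfolding satisfies_recursive_equation_def by blast
  define y where "y = (\<lambda>i. 1 / v i - v i)"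
  have y: "recursive_sequence eq_E n y" for n
    unfolding y_def by (rule recursive_sequence_L_imp_E[OF v(1)])
  obtain \<theta> where \<theta>: "\<And>n. subfield_hom (F n) \<theta>" "\<And>i. \<theta> (x i) = y i"
    using eq_E_tower_hom[of x y] x y by auto
  have mono: "F m \<subseteq> F n" if "m \<le> n" for m n
    unfolding x(2) using that by (intro Q_adjoin_mono image_mono) auto
  have common: "\<exists>n. a \<in> F n \<and> b \<in> F n" if "a \<in> (\<Union>n. F n)" "b \<in> (\<Union>n. F n)" for a b
  proof -
    from that obtain m n where "a \<in> F m" "b \<in> F n" by blast
    hence "a \<in> F (max m n)" "b \<in> F (max m n)" using mono[of m "max m n"] mono[of n "max m n"] by auto
    thus ?thesis by blast
  qed
  have "\<theta> \<in> ring_hom (ring_of_type_algebra\<lparr>carrier := (\<Union>n. F n)\<rparr>) ring_of_type_algebra"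
  proof (rule ring_hom_memI)
    fix a b assume "a \<in> carrier (ring_of_type_algebra\<lparr>carrier := (\<Union>n. F n)\<rparr>)"
      "b \<in> carrier (ring_of_type_algebra\<lparr>carrier := (\<Union>n. F n)\<rparr>)"
    with common[of a b] obtain n where ab: "a \<in> F n" "b \<in> F n" by auto
    show "\<theta> (a \<otimes>\<^bsub>ring_of_type_algebra\<lparr>carrier := (\<Union>n. F n)\<rparr>\<^esub> b) = \<theta> a \<otimes>\<^bsub>ring_of_type_algebra\<^esub> \<theta> b"
      using subfield_hom.hom_mult[OF \<theta>(1) ab] by simp
    show "\<theta> (a \<oplus>\<^bsub>ring_of_type_algebra\<lparr>carrier := (\<Union>n. F n)\<rparr>\<^esub> b) = \<theta> a \<oplus>\<^bsub>ring_of_type_algebra\<^esub> \<theta> b"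
      using subfield_hom.hom_add[OF \<theta>(1) ab] by simp
  qed (use subfield_hom.hom_one[OF \<theta>(1)] in simp_all)
  moreover have "\<theta> ` F n \<subseteq> G n" for n
  proof -
    have "\<theta> ` F n = Q_adjoin (y ` {..n})"
      using image_Q_adjoin[OF \<theta>(1)[of n, unfolded x(2)]] \<theta>(2) by (simp add: x(2) image_image)
    thus ?thesis unfolding v(2) y_def using Q_adjoin_inverse_diff_subset by simp
  qed
  ultimately show ?thesis unfolding is_supertower_def by blast
qed

theorem mainTheorem3:
  shows
    "(\<forall>x y v :: 'a::field_char_0.
        \<not> Polynomial.algebraic x \<longrightarrow> eq_E x y \<longrightarrow> 1 / v - v = x \<longrightarrow>
        (\<exists>w \<in> Q_adjoin {v, y}.
           w \<noteq> 0 \<and> 1 / w - w = y \<and>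
           w^5 = v * ((v^4 - 3*v^3 + 4*v^2 - 2*v + 1) / (v^4 + 2*v^3 + 4*v^2 + 3*v + 1))))
   \<and> (\<forall>n (v :: nat \<Rightarrow> 'a).
        recursive_sequence eq_L n v \<longrightarrow>
        recursive_sequence eq_E n (\<lambda>i. 1 / v i - v i) \<and>
        Q_adjoin ((\<lambda>i. 1 / v i - v i) ` {..n}) \<subseteq> Q_adjoin (v ` {..n}))
   \<and> (satisfies_recursive_equation X0_tower eq_E \<longrightarrow>
      (\<forall>G :: nat \<Rightarrow> 'a set.
         satisfies_recursive_equation G eq_L \<longrightarrow> is_supertower G X0_tower))"
  using exists_root_in_adjunction recursive_sequence_L_imp_E Q_adjoin_inverse_diff_subset
    eq_L_tower_is_supertower
  by blast

end
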